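(* (i) Let $S\equiv\pm\{1, 5, 6, 8, 9, 10, 11, 13, 15, 19, 20, 23\}\pmod{48}$ and $T\equiv\pm\{1, 4, 5, 7, 9, 10, 15, 17, 18, 19, 20, 23\}\pmod{48}$. Then $p(S,n)=p(T,n-1)$ for all $n\geq 1$. (ii) Let $S\equiv\pm\{1, 2, 3, 4, 5, 6, 11, 13, 19, 20, 21, 23\}\pmod{48}$ and $T\equiv\pm\{1, 2, 3, 4, 5, 7, 8, 17, 18, 19, 21, 23\}\pmod{48}$. Then $p(S,n)=p(T,n)$ for all integers $n\ge0$ with $n\neq 6$. (iii) Let $S\equiv\pm\{4, 5, 6, 7, 8, 9, 11, 13, 15, 17, 19, 22\}\pmod{48}$ and $T\equiv\pm\{1, 4, 7, 9, 11, 13, 15, 17, 18, 20, 22, 23\}\pmod{48}$. Then $p(S,n)=p(T,n-4)$ for all $n\geq 4$. (iv) Let $S\equiv\pm\{3, 4, 5, 6, 7, 11, 13, 14, 17, 19, 20, 21\}\pmod{48}$ and $T\equiv\pm\{1, 3, 7, 8, 11, 13, 14, 17, 18, 20, 21, 23\}\pmod{48}$. Then $p(S,n)=p(T,n-3)$ for all $n\geq 3$.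
   Context: For a set $S$ of positive integers and an integer $n\ge 0$, $p(S,n)$ denotes the number of partitions of $n$ into parts belonging to $S$ (so $p(S,0)=1$). The notation $S\equiv\pm\{r_1,\dots,r_k\}\pmod M$ means that $S$ is the set of all positive integers $n$ such that $n\equiv r_i$ or $n\equiv -r_i\pmod M$ for some $i$. *)

theory Defs
  imports "HOL-Library.Multiset" "HOL-Number_Theory.Cong"
begin

definition partitions_into :: "nat set \<Rightarrow> nat \<Rightarrow> nat multiset set" where
  "partitions_into S n = {P. set_mset P \<subseteq> S \<and> sum_mset P = n}"

text \<open>Only meant for sets \<open>S\<close> of positive integers: if \<open>0 \<in> S\<close>, the set of partitions may be
  infinite and its cardinality is then \<open>0\<close> by convention.\<close>

definition num_partitions :: "nat set \<Rightarrow> nat \<Rightarrow> nat" where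
  "num_partitions S n = card (partitions_into S n)"

definition pm_residues :: "nat set \<Rightarrow> nat \<Rightarrow> nat set" where
  "pm_residues R M =
     {n. n > 0 \<and> (\<exists>r\<in>R. [int n = int r] (mod int M) \<or> [int n = - int r] (mod int M))}"

lemma zero_notin_pm_residues: "0 \<notin> pm_residues R M"
  by (simp add: pm_residues_def)

lemma size_le_sum_mset:
  assumes "0 \<notin># (P :: nat multiset)"
  shows "size P \<le> sum_mset P"
  using assms by (induction P) (auto simp: Suc_le_eq)

lemma finite_partitions_into:
  assumes "0 \<notin> S"
  shows "finite (partitions_into S n)"
proof (rule finite_subset)
  show "partitions_into S n \<subseteq> mset ` {xs. set xs \<subseteq> {..n} \<and> length xs \<le> n}"
  proof
    fix P assume P: "P \<in> partitions_into S n"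
    then have sum: "sum_mset P = n" and "0 \<notin># P"
      using assms by (auto simp: partitions_into_def)
    then have "size P \<le> n"
      using size_le_sum_mset by blast
    moreover have "set_mset P \<subseteq> {..n}"
    proof
      fix x assume "x \<in># P"
      then obtain Q where "P = add_mset x Q"
        by (blast dest: multi_member_split)
      then show "x \<in> {..n}" using sum by simp
    qed
    moreover obtain xs where "P = mset xs"
      using ex_mset by metis
    ultimately show "P \<in> mset ` {xs. set xs \<subseteq> {..n} \<and> length xs \<le> n}"
      by auto
  qed
  show "finite (mset ` {xs. set xs \<subseteq> {..n} \<and> length xs \<le> n})"
    by (intro finite_imageI finite_lists_length_le) simp
qed

lemma num_partitions_0:
  assumes "0 \<notin> S"
  shows "num_partitions S 0 = 1"
proof -
  have "P = {#}" if "P \<in> partitions_into S 0" for P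
  proof -
    have "0 \<notin># P" and "sum_mset P = 0"
      using that assms unfolding partitions_into_def by blast+
    then show ?thesis
      using size_le_sum_mset[of P] by (metis le_zero_eq size_eq_0_iff_empty)
  qed
  then have "partitions_into S 0 = {{#}}"
    by (auto simp: partitions_into_def)
  then show ?thesis by (simp add: num_partitions_def)
qed

end

theory Submission
  imports Defs "HOL-Complex_Analysis.Cauchy_Integral_Formula"
begin

text \<open>
  The generating function of the partitions into parts \<open>\<equiv> \<plusminus>R (mod 48)\<close> is the reciprocal of the
  product of the theta functions \<open>\<theta>(q\<^sup>r; q\<^sup>4\<^sup>8)\<close>, \<open>r \<in> R\<close>, so each part of the theorem says that
  a difference of two products of four thetas is a product of sixteen, up to powers of \<open>q\<close>.
  Written in base \<open>q\<^sup>2\<^sup>4\<close> with arguments \<open>\<plusminus>q\<^sup>k\<close>, and after duplication formulas have equalised the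
  numbers of factors, this becomes a homogeneous identity between products of theta values at
  torsion points, and it is a linear combination of twelve multiples of Weierstrass' three-term
  relation. The four parts are conjugate: they arise from one identity by \<open>k \<mapsto> a k\<close> with
  \<open>a = 1, 5, 7, 11\<close>. The three-term relation itself is a Pluecker relation, because by the Jacobi
  triple product \<open>\<theta>(cxy) \<theta>(x/y) / x\<close> has the form \<open>A(x) B(y) - A(y) B(x)\<close>.
\<close>

section \<open>Theta functions\<close>

text \<open>In each part let \<open>c\<close> be the product of the eight thetas common to
  \<open>S\<close> and \<open>T\<close>, and \<open>s\<close>, \<open>t\<close> the products of the
  four that remain. In generating functions the claim reads
  \<open>1 / (c * s) = q ^ i + q ^ k / (c * t)\<close>; multiplied by \<open>c * s * t\<close> it is
  the theta identity. The monomial \<open>q ^ i\<close> disturbs one coefficient only: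
  \<open>i = 0\<close> in (i), (iii), (iv), where \<open>n \<ge> k > 0\<close> avoids it, and
  \<open>i = 6\<close> in (ii), the exception made there. Base \<open>q ^ 24\<close> is chosen
  because a pair of thetas at \<open>r\<close> and \<open>24 - r\<close> merges into one theta of
  that base, and a single theta at \<open>2 * k\<close> into the product of those at
  \<open>q ^ k\<close> and \<open>- (q ^ k)\<close>. The numbers 1, 5, 7, 11 represent the units
  modulo 24 up to sign, and normalised thetas depend on an index modulo 24 and up to sign only
  through sign factors. Real \<open>q\<close> between 0 and 1 suffices: positivity of the thetas
  justifies every cancellation, and a power series is determined by its values there.\<close>

definition qpoch :: "real \<Rightarrow> real \<Rightarrow> real" where
  "qpoch a p = (\<Prod>n. 1 - a * p ^ n)"

text \<open>The modified theta function: Jacobi's triple product without the factor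
  \<open>qpoch p p\<close>, which has no counterpart in the partition products.\<close>

definition theta :: "real \<Rightarrow> real \<Rightarrow> real" where
  "theta a p = qpoch a p * qpoch (p / a) p"

lemma convergent_prod_qpoch:
  fixes a p :: real
  assumes "0 < p" "p < 1"
  shows "convergent_prod (\<lambda>n. 1 - a * p ^ n)"
proof -
  have "summable (\<lambda>i. \<bar>a\<bar> * p ^ i)"
    using assms by (intro summable_mult summable_geometric) auto
  then have "summable (\<lambda>i. norm (1 - a * p ^ i - 1))"
    using assms by (simp add: abs_mult)
  then show ?thesis
    by (intro abs_convergent_prod_imp_convergent_prod summable_imp_abs_convergent_prod)
qed

lemma qpoch_LIMSEQ:
  assumes "0 < p" "p < 1"
  shows "(\<lambda>n. \<Prod>i<n. 1 - a * p ^ i) \<longlonglongrightarrow> qpoch a p"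
proof -
  from convergent_prod_LIMSEQ[OF convergent_prod_qpoch[OF assms]] show ?thesis
    unfolding qpoch_def
    by (subst filterlim_sequentially_Suc[symmetric]) (simp add: lessThan_Suc_atMost)
qed

lemma qpoch_pos:
  assumes "0 < p" "p < 1" "a < 1"
  shows "qpoch a p > 0"
  unfolding qpoch_def
proof (rule less_0_prodinf[OF convergent_prod_qpoch[OF assms(1,2)]])
  fix i
  have "0 < p ^ i" "p ^ i \<le> 1" using assms by (auto intro: power_le_one)
  then have "a * p ^ i < 1"
    using assms
    by (metis mult_less_cancel_right2 not_less order.strict_trans2)
  then show "0 < 1 - a * p ^ i" by simp
qed

lemma qpoch_rec:
  assumes "0 < p" "p < 1"
  shows "qpoch a p = (1 - a) * qpoch (p * a) p"
proof (rule LIMSEQ_unique)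
  show "(\<lambda>n. \<Prod>i<Suc n. 1 - a * p ^ i) \<longlonglongrightarrow> qpoch a p"
    using qpoch_LIMSEQ[OF assms] by (rule LIMSEQ_Suc)
  have "(\<Prod>i<Suc n. 1 - a * p ^ i) = (1 - a) * (\<Prod>i<n. 1 - (p * a) * p ^ i)" for n
    by (subst prod.lessThan_Suc_shift) (simp add: mult_ac)
  then show "(\<lambda>n. \<Prod>i<Suc n. 1 - a * p ^ i) \<longlonglongrightarrow> (1 - a) * qpoch (p * a) p"
    by (simp only:) (intro tendsto_intros qpoch_LIMSEQ assms)
qed

lemma qpoch_split:
  assumes "0 < p" "p < 1"
  shows "qpoch a p = qpoch a (p\<^sup>2) * qpoch (a * p) (p\<^sup>2)"
proof (rule LIMSEQ_unique)
  have p2: "0 < p\<^sup>2" "p\<^sup>2 < 1" using assms by (auto simp: power_less_one_iff)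
  have "(\<Prod>i<2 * n. 1 - a * p ^ i)
      = (\<Prod>i<n. 1 - a * (p\<^sup>2) ^ i) * (\<Prod>i<n. 1 - (a * p) * (p\<^sup>2) ^ i)" for n
    by (induction n) (simp_all add: power_mult[symmetric] mult_ac)
  then show "(\<lambda>n. \<Prod>i<2 * n. 1 - a * p ^ i) \<longlonglongrightarrow> qpoch a (p\<^sup>2) * qpoch (a * p) (p\<^sup>2)"
    by (simp only:) (intro tendsto_intros qpoch_LIMSEQ p2)
  have "filterlim (\<lambda>n::nat. 2 * n) at_top sequentially"
    by (rule filterlim_subseq) (simp add: strict_mono_def)
  from filterlim_compose[OF qpoch_LIMSEQ[OF assms] this]
  show "(\<lambda>n. \<Prod>i<2 * n. 1 - a * p ^ i) \<longlonglongrightarrow> qpoch a p" .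
qed

lemma qpoch_square:
  assumes "0 < p" "p < 1"
  shows "qpoch a p * qpoch (- a) p = qpoch (a\<^sup>2) (p\<^sup>2)"
proof (rule LIMSEQ_unique)
  have p2: "0 < p\<^sup>2" "p\<^sup>2 < 1" using assms by (auto simp: power_less_one_iff)
  have "(1 - a * p ^ i) * (1 - (- a) * p ^ i) = 1 - a\<^sup>2 * (p\<^sup>2) ^ i" for i
    by (simp add: algebra_simps power2_eq_square power_mult_distrib)
  then have "(\<Prod>i<n. 1 - a * p ^ i) * (\<Prod>i<n. 1 - (- a) * p ^ i)
      = (\<Prod>i<n. 1 - a\<^sup>2 * (p\<^sup>2) ^ i)" for n
    by (simp add: prod.distrib[symmetric])
  then show "(\<lambda>n. (\<Prod>i<n. 1 - a * p ^ i) * (\<Prod>i<n. 1 - (- a) * p ^ i)) \<longlonglongrightarrow> qpoch (a\<^sup>2) (p\<^sup>2)"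
    by (simp only:) (intro qpoch_LIMSEQ p2)
  show "(\<lambda>n. (\<Prod>i<n. 1 - a * p ^ i) * (\<Prod>i<n. 1 - (- a) * p ^ i)) \<longlonglongrightarrow> qpoch a p * qpoch (- a) p"
    by (intro tendsto_intros qpoch_LIMSEQ assms)
qed

lemma theta_pos:
  assumes "0 < p" "p < a" "a < 1"
  shows "theta a p > 0"
  unfolding theta_def using assms by (intro mult_pos_pos qpoch_pos) auto

lemma theta_neg_pos:
  assumes "0 < p" "p < 1" "a < 0"
  shows "theta a p > 0"
  unfolding theta_def using assms
  by (intro mult_pos_pos qpoch_pos) (auto intro: order.strict_trans[OF divide_pos_neg])

lemma theta_reflect: "0 < p \<Longrightarrow> a \<noteq> 0 \<Longrightarrow> theta (p / a) p = theta a p"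
  by (simp add: theta_def mult.commute)

text \<open>Once the factor \<open>1 - a\<close> is split off, the remaining product is symmetric
  under inversion of \<open>a\<close>, so only the quotient of \<open>1 - 1 / a\<close> by
  \<open>1 - a\<close> survives.\<close>

lemma theta_inverse:
  assumes "0 < p" "p < 1" "a \<noteq> 0"
  shows "theta (1 / a) p = - theta a p / a"
proof -
  have "theta (1 / a) p = (1 - 1 / a) * qpoch (p / a) p * qpoch (p * a) p"
    using qpoch_rec[OF assms(1,2), of "1 / a"] by (simp add: theta_def)
  moreover have "theta a p = (1 - a) * qpoch (p * a) p * qpoch (p / a) p"
    using qpoch_rec[OF assms(1,2), of a] by (simp add: theta_def)
  ultimately show ?thesis using assms by (simp add: field_simps)
qed

lemma theta_shift:
  assumes "0 < p" "p < 1" "a \<noteq> 0"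
  shows "theta (p * a) p = - theta a p / a"
  using theta_reflect[of p "1 / a"] theta_inverse[OF assms] assms by simp

text \<open>The factors are sorted by the parity of the exponent, whereas
  \<open>theta_square\<close> pairs factors as \<open>(1 - u) * (1 + u)\<close>. These two passages
  between the bases \<open>p\<close> and \<open>p ^ 2\<close> yield all duplication formulas used
  later.\<close>

lemma theta_split:
  assumes "0 < p" "p < 1" "a \<noteq> 0"
  shows "theta a p = theta a (p\<^sup>2) * theta (p * a) (p\<^sup>2)"
  using qpoch_split[OF assms(1,2), of a] qpoch_split[OF assms(1,2), of "p / a"] assms
  by (simp add: theta_def power2_eq_square mult_ac)

lemma theta_square:
  assumes "0 < p" "p < 1" "a \<noteq> 0"
  shows "theta a p * theta (- a) p = theta (a\<^sup>2) (p\<^sup>2)"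
  using qpoch_square[OF assms(1,2), of a] qpoch_square[OF assms(1,2), of "p / a"] assms
  by (simp add: theta_def power_divide mult_ac)

section \<open>The Jacobi triple product\<close>

fun gauss_binomial :: "real \<Rightarrow> nat \<Rightarrow> nat \<Rightarrow> real" where
  "gauss_binomial p n 0 = 1"
| "gauss_binomial p 0 (Suc k) = 0"
| "gauss_binomial p (Suc n) (Suc k) = gauss_binomial p n k + p ^ Suc k * gauss_binomial p n (Suc k)"

lemma gauss_binomial_eq_0: "n < k \<Longrightarrow> gauss_binomial p n k = 0"
  by (induction p n k rule: gauss_binomial.induct) auto

text \<open>The induction peels off the factor \<open>1 + x\<close> and applies the hypothesis at
  \<open>x * p\<close>, so \<open>x\<close> has to stay arbitrary. Comparing coefficients of
  \<open>x ^ Suc k\<close> then gives the Pascal rule of the definition.\<close>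

lemma q_binomial_theorem:
  "(\<Prod>i<n. 1 + x * p ^ i) = (\<Sum>k\<le>n. gauss_binomial p n k * p ^ (k choose 2) * x ^ k)"
proof (induction n arbitrary: x)
  case (Suc n)
  let ?g = "\<lambda>k. gauss_binomial p n k * p ^ (k choose 2)"
  have choose: "Suc k choose 2 = k + (k choose 2)" for k
    by (simp add: numeral_2_eq_2)
  have ext: "(\<Sum>k\<le>Suc n. gauss_binomial p n k * c k) = (\<Sum>k\<le>n. gauss_binomial p n k * c k)" for c
    by (simp add: gauss_binomial_eq_0)
  have "(\<Prod>i<Suc n. 1 + x * p ^ i) = (1 + x) * (\<Prod>i<n. 1 + (x * p) * p ^ i)"
    by (subst prod.lessThan_Suc_shift) (simp add: mult_ac)
  also have "\<dots> = (\<Sum>k\<le>n. ?g k * (x * p) ^ k) + (\<Sum>k\<le>n. ?g k * p ^ k * x ^ Suc k)"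
    unfolding Suc.IH by (simp add: distrib_right sum_distrib_left sum.distrib power_mult_distrib
        mult_ac)
  also have "(\<Sum>k\<le>n. ?g k * (x * p) ^ k) = (\<Sum>k\<le>Suc n. ?g k * (x * p) ^ k)"
    using ext[of "\<lambda>k. p ^ (k choose 2) * (x * p) ^ k"] by (simp add: mult.assoc)
  also have "\<dots> = 1 + (\<Sum>k\<le>n. ?g (Suc k) * (x * p) ^ Suc k)"
    by (subst sum.atMost_Suc_shift) (simp add: numeral_2_eq_2)
  also have "1 + (\<Sum>k\<le>n. ?g (Suc k) * (x * p) ^ Suc k) + (\<Sum>k\<le>n. ?g k * p ^ k * x ^ Suc k)
     = 1 + (\<Sum>k\<le>n. gauss_binomial p (Suc n) (Suc k) * p ^ (Suc k choose 2) * x ^ Suc k)"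
    by (simp add: sum.distrib[symmetric] choose power_add power_mult_distrib algebra_simps)
  also have "\<dots> = (\<Sum>k\<le>Suc n. gauss_binomial p (Suc n) k * p ^ (k choose 2) * x ^ k)"
    by (subst sum.atMost_Suc_shift) (simp add: numeral_2_eq_2)
  finally show ?case .
qed (simp add: numeral_2_eq_2)

text \<open>The quotient formula for Gaussian binomials is kept multiplied out, so no factor has to
  be nonzero. The induction rests on \<open>1 - p ^ Suc k + p ^ Suc k * (1 - p ^ (n - k)) = 1 - p ^
  Suc n\<close>.\<close>

lemma gauss_binomial_closed:
  assumes "k \<le> n"
  shows "gauss_binomial p n k * ((\<Prod>i<k. 1 - p ^ Suc i) * (\<Prod>i<n - k. 1 - p ^ Suc i))
       = (\<Prod>i<n. 1 - p ^ Suc i)"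
  using assms
proof (induction p n k rule: gauss_binomial.induct)
  case (3 p n k)
  let ?Q = "\<lambda>m. \<Prod>i<m. 1 - p ^ Suc i"
  show ?case
  proof (cases "k = n")
    case True
    then show ?thesis using 3 by (simp add: gauss_binomial_eq_0 mult_ac)
  next
    case False
    with 3 have kn: "Suc k \<le> n" by simp
    then have n: "n - k = Suc (n - Suc k)" by simp
    have e: "p ^ Suc k * p ^ (n - k) = p ^ Suc n"
      using kn by (simp flip: power_add power_Suc)
    have "gauss_binomial p (Suc n) (Suc k) * (?Q (Suc k) * ?Q (Suc n - Suc k))
      = gauss_binomial p n k * (?Q k * ?Q (n - k)) * (1 - p ^ Suc k)
       + p ^ Suc k * (gauss_binomial p n (Suc k) * (?Q (Suc k) * ?Q (n - Suc k))) * (1 - p ^ (n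
           - k))"
      by (simp add: n algebra_simps)
    also have "\<dots> = ?Q n * (1 - p ^ Suc k + p ^ Suc k * (1 - p ^ (n - k)))"
      using "3.IH" kn by (simp only: le_SucI Suc_leD) (simp add: algebra_simps)
    also have "\<dots> = ?Q n * (1 - p ^ Suc n)"
      by (simp only: right_diff_distrib e) (simp add: right_diff_distrib)
    finally show ?thesis by simp
  qed
qed auto

section \<open>The bilateral series and its finite form\<close>

definition jtp_term :: "real \<Rightarrow> real \<Rightarrow> int \<Rightarrow> real" where
  "jtp_term p a j = p powi (j * (j - 1) div 2) * (- a) powi j"

lemma two_mult_choose_two: "2 * int (k choose 2) = int k * (int k - 1)"
  by (induction k) (auto simp: numeral_2_eq_2 algebra_simps)

lemma jtp_term_of_nat: "jtp_term p a (int m) = p ^ (m choose 2) * (- a) ^ m"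
proof -
  have "int m * (int m - 1) div 2 = int (m choose 2)"
    using two_mult_choose_two[of m] by linarith
  then show ?thesis by (simp add: jtp_term_def power_int_of_nat)
qed

text \<open>The right-hand side is the term at \<open>m + 1\<close> for the argument
  \<open>p / a\<close>, reflecting the symmetry of \<open>theta\<close> under
  \<open>a \<mapsto> p / a\<close>. One estimate therefore handles both halves of the
  series.\<close>

lemma jtp_term_neg:
  assumes "p > 0"
  shows "jtp_term p a (- int m - 1) = p ^ (Suc m choose 2) * (- p / a) ^ Suc m"
proof -
  have "(- int m - 1) * (- int m - 1 - 1) = 2 * int ((Suc m choose 2) + Suc m)"
    using two_mult_choose_two[of "Suc m"] by (simp add: algebra_simps)
  then have e1: "(- int m - 1) * (- int m - 1 - 1) div 2 = int ((Suc m choose 2) + Suc m)"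
    by simp
  have e2: "(- a) powi (- int m - 1) = (- 1 / a) ^ Suc m"
  proof -
    have "- int m - 1 = - int (Suc m)" by simp
    then have "(- a) powi (- int m - 1) = inverse ((- a) ^ Suc m)"
      by (simp only: power_int_minus power_int_of_nat)
    then show ?thesis by (simp add: divide_inverse flip: power_inverse del: power_Suc)
  qed
  show ?thesis
    unfolding jtp_term_def e1 e2 power_int_of_nat power_add mult.assoc power_mult_distrib[symmetric]
    by simp
qed

text \<open>Extracting \<open>- (p / a * p ^ i)\<close> from each factor of the second product
  leaves \<open>1 - a / p ^ Suc i\<close>. The two products then merge into one over
  \<open>2 * n\<close> consecutive powers starting at \<open>a / p ^ n\<close>, to which the
  binomial theorem applies; the extracted monomials shift the summation index by
  \<open>n\<close>.\<close>

lemma finite_jacobi_triple_product: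
  assumes p: "0 < p" and a: "a \<noteq> 0"
  shows "(\<Prod>i<n. 1 - a * p ^ i) * (\<Prod>i<n. 1 - p / a * p ^ i)
       = (\<Sum>k\<le>2 * n. gauss_binomial p (2 * n) k * jtp_term p a (int k - int n))"
proof -
  have c: "(\<Prod>i<n. - (p / a * p ^ i)) = p ^ (Suc n choose 2) * (- a) powi (- int n)"
    using p a
    by (induction n)
       (simp_all add: numeral_2_eq_2 power_add power_int_add power_int_diff power_int_minus
           field_simps)
  have "(\<Prod>i<n. 1 - a / p ^ n * p ^ i) = (\<Prod>i<n. 1 - a / p ^ Suc i)"
    by (rule prod.reindex_bij_witness[of _ "\<lambda>i. n - Suc i" "\<lambda>i. n - Suc i"])
       (use p in \<open>auto simp: field_simps Suc_diff_Suc simp flip: power_add power_Suc\<close>)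
  then have "(\<Prod>i<n. - (p / a * p ^ i)) * (\<Prod>i<n. 1 - a / p ^ n * p ^ i)
      = (\<Prod>i<n. 1 - p / a * p ^ i)"
    using p a by (simp only: prod.distrib[symmetric]) (auto intro!: prod.cong simp: field_simps)
  moreover have "(\<Prod>i<2 * n. 1 - a / p ^ n * p ^ i)
      = (\<Prod>i<n. 1 - a / p ^ n * p ^ i) * (\<Prod>i<n. 1 - a * p ^ i)"
  proof -
    have "(\<Prod>i<n + m. 1 - a / p ^ n * p ^ i)
      = (\<Prod>i<n. 1 - a / p ^ n * p ^ i) * (\<Prod>i<m. 1 - a * p ^ i)" for m
      using p by (induction m) (simp_all add: power_add field_simps)
    from this[of n] show ?thesis by (simp add: mult_2)
  qed
  ultimately have "(\<Prod>i<n. 1 - a * p ^ i) * (\<Prod>i<n. 1 - p / a * p ^ i)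
      = (\<Prod>i<n. - (p / a * p ^ i)) * (\<Prod>i<2 * n. 1 + - (a / p ^ n) * p ^ i)"
    by simp
  also have "\<dots> = (\<Sum>k\<le>2 * n. gauss_binomial p (2 * n) k * jtp_term p a (int k - int n))"
    unfolding q_binomial_theorem c sum_distrib_left
  proof (rule sum.cong)
    fix k
    have "(int k - int n) * (int k - int n - 1)
       = 2 * (int (Suc n choose 2) + int (k choose 2) - int n * int k)"
      using two_mult_choose_two[of k] two_mult_choose_two[of "Suc n"] by (simp add: algebra_simps)
    then have e: "(int k - int n) * (int k - int n - 1) div 2
       = int (Suc n choose 2) + int (k choose 2) - int (n * k)"
      by simp
    have e': "(- (a / p ^ n)) ^ k = (- a) ^ k / p ^ (n * k)"
      by (simp only: minus_divide_left power_divide power_mult)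
    show "p ^ (Suc n choose 2) * (- a) powi (- int n) *
       (gauss_binomial p (2 * n) k * p ^ (k choose 2) * (- (a / p ^ n)) ^ k)
      = gauss_binomial p (2 * n) k * jtp_term p a (int k - int n)"
      unfolding jtp_term_def e e' using p a
      by (simp add: power_int_add power_int_diff power_int_minus field_simps del: of_nat_mult
          of_nat_add)
  qed simp
  finally show ?thesis .
qed

lemma summable_triangular_powers:
  fixes p x :: real
  assumes "0 < p" "p < 1"
  shows "summable (\<lambda>m. p ^ (m choose 2) * \<bar>x\<bar> ^ m)"
proof -
  have "(\<lambda>n. p ^ n * \<bar>x\<bar>) \<longlonglongrightarrow> 0 * \<bar>x\<bar>"
    using assms by (intro tendsto_intros LIMSEQ_realpow_zero) auto
  then have "eventually (\<lambda>n. p ^ n * \<bar>x\<bar> < 1 / 2) sequentially"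
    by (rule order_tendstoD) simp
  then obtain N where N: "\<And>n. n \<ge> N \<Longrightarrow> p ^ n * \<bar>x\<bar> < 1 / 2"
    by (auto simp: eventually_sequentially)
  show ?thesis
  proof (rule summable_ratio_test[of "1 / 2" N])
    fix n assume "N \<le> n"
    then have "p ^ (n choose 2) * \<bar>x\<bar> ^ n * (p ^ n * \<bar>x\<bar>) \<le> p ^ (n choose 2) * \<bar>x\<bar> ^ n * (1 / 2)"
      using assms N[of n] by (intro mult_left_mono) auto
    then show "norm (p ^ (Suc n choose 2) * \<bar>x\<bar> ^ Suc n) \<le> 1 / 2 *
        norm (p ^ (n choose 2) * \<bar>x\<bar> ^ n)"
      using assms by (simp add: numeral_2_eq_2 power_add mult_ac abs_mult)
  qed simp
qed

lemma summable_jtp_term: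
  assumes "0 < p" "p < 1"
  shows "summable (\<lambda>m. norm (jtp_term p a (int m)))"
    and "summable (\<lambda>m. norm (jtp_term p a (- int m - 1)))"
proof -
  show "summable (\<lambda>m. norm (jtp_term p a (int m)))"
    using summable_triangular_powers[OF assms, of a] assms
    by (simp add: jtp_term_of_nat abs_mult power_abs)
  have "summable (\<lambda>m. p ^ (Suc m choose 2) * \<bar>- p / a\<bar> ^ Suc m)"
    using summable_triangular_powers[OF assms, of "- p / a"]
    by (rule summable_Suc_iff[THEN iffD2])
  then show "summable (\<lambda>m. norm (jtp_term p a (- int m - 1)))"
    using assms by (simp only: jtp_term_neg abs_mult power_abs real_norm_def abs_of_pos)
qed

lemma has_sum_int_split:
  fixes f :: "int \<Rightarrow> real"
  assumes "summable (\<lambda>m. norm (f (int m)))" "summable (\<lambda>m. norm (f (- int m - 1)))"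
  shows "(f has_sum ((\<Sum>m. f (int m)) + (\<Sum>m. f (- int m - 1)))) UNIV"
proof -
  have 1: "((\<lambda>m. f (int m)) has_sum (\<Sum>m. f (int m))) UNIV"
    using assms(1) by (intro norm_summable_imp_has_sum summable_sums summable_norm_cancel[OF
        assms(1)])
  have 2: "((\<lambda>m. f (- int m - 1)) has_sum (\<Sum>m. f (- int m - 1))) UNIV"
    using assms(2) by (intro norm_summable_imp_has_sum summable_sums summable_norm_cancel[OF
        assms(2)])
  have 1: "(f has_sum (\<Sum>m. f (int m))) {0..}"
    using 1 by (subst (asm) has_sum_reindex_bij_witness[of _ nat int "{0..}" f]) auto
  have 2: "(f has_sum (\<Sum>m. f (- int m - 1))) {..<0}"
    using 2 by (subst (asm) has_sum_reindex_bij_witness[of _ "\<lambda>j. nat (- j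
        - 1)" "\<lambda>m. - int m - 1" "{..<0}" f]) auto
  have "{0..} \<union> {..<0} = (UNIV :: int set)" by auto
  with has_sum_Un_disjoint[OF 1 2] show ?thesis by (simp add: disjoint_iff)
qed

text \<open>When the index and its complement both tend to infinity, all three products of the
  closed form tend to \<open>E = qpoch p p\<close>, leaving \<open>E / (E * E)\<close>.\<close>

lemma gauss_binomial_limit:
  assumes p: "0 < p" "p < 1" and "\<And>n. n \<ge> N \<Longrightarrow> k n \<le> 2 * n"
    and "filterlim k at_top sequentially" "filterlim (\<lambda>n. 2 * n - k n) at_top sequentially"
  shows "(\<lambda>n. gauss_binomial p (2 * n) (k n)) \<longlonglongrightarrow> 1 / qpoch p p"
proof -
  define Q where "Q m = (\<Prod>i<m. 1 - p ^ Suc i)" for m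
  have Q: "Q \<longlonglongrightarrow> qpoch p p"
    using qpoch_LIMSEQ[OF p, of p] by (simp add: Q_def [abs_def])
  have Q0: "Q m > 0" for m
    unfolding Q_def using p power_Suc_less_one[of p] by (intro prod_pos) auto
  have E: "qpoch p p > 0" by (rule qpoch_pos) (use p in auto)
  have "filterlim (\<lambda>n::nat. 2 * n) at_top sequentially"
    by (rule filterlim_subseq) (simp add: strict_mono_def)
  then have "(\<lambda>n. Q (2 * n) / (Q (k n) * Q (2 * n - k n))) \<longlonglongrightarrow> qpoch p p / (qpoch p p * qpoch p p)"
    using E assms(4,5)
    by (intro tendsto_intros filterlim_compose[OF Q]) auto
  moreover have "eventually (\<lambda>n. Q (2 * n) / (Q (k n) * Q (2 * n - k n))
      = gauss_binomial p (2 * n) (k n)) sequentially"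
    using eventually_ge_at_top[of N]
  proof eventually_elim
    case (elim n)
    have "Q (k n) * Q (2 * n - k n) \<noteq> 0" using Q0 by (metis mult_pos_pos less_irrefl)
    then show ?case
      using gauss_binomial_closed[OF assms(3)[OF elim], of p, folded Q_def] by (simp add:
          field_simps)
  qed
  ultimately show ?thesis
    using E by (simp cong: filterlim_cong)
qed

text \<open>The partial products are at most 1 and decrease to \<open>qpoch p p\<close>, which
  bounds the closed form independently of \<open>n\<close> and \<open>k\<close>. This is the
  domination needed to exchange limit and sum.\<close>

lemma gauss_binomial_bound:
  assumes p: "0 < p" "p < 1"
  shows "\<bar>gauss_binomial p n k\<bar> \<le> 1 / (qpoch p p)\<^sup>2"
proof (cases "k \<le> n")
  case True
  define Q where "Q m = (\<Prod>i<m. 1 - p ^ Suc i)" for m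
  have Q: "Q \<longlonglongrightarrow> qpoch p p"
    using qpoch_LIMSEQ[OF p, of p] by (simp add: Q_def [abs_def])
  have f: "0 < 1 - p ^ Suc i" "1 - p ^ Suc i \<le> 1" for i
    using p power_Suc_less_one[of p] by auto
  have Q0: "Q m > 0" for m
    unfolding Q_def using f by (intro prod_pos) auto
  have "decseq Q"
    unfolding Q_def decseq_Suc_iff using f Q0[unfolded Q_def]
    by (auto intro!: mult_right_le_one_le order.strict_implies_order simp del: power_Suc)
  then have QE: "Q m \<ge> qpoch p p" for m using decseq_ge[OF _ Q] by blast
  have Q1: "Q m \<le> 1" for m unfolding Q_def using f by (intro prod_le_1) (auto simp: less_imp_le)
  have E: "qpoch p p > 0" by (rule qpoch_pos) (use p in auto)
  have "Q k * Q (n - k) \<ge> qpoch p p * qpoch p p"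
    using E QE by (intro mult_mono) (auto intro: less_imp_le[OF Q0])
  moreover have "gauss_binomial p n k = Q n / (Q k * Q (n - k))"
    using gauss_binomial_closed[OF True, of p, folded Q_def] Q0[of k] Q0[of "n - k"]
    by (simp add: field_simps)
  ultimately show ?thesis
    using Q0[of n] Q0[of k] Q0[of "n - k"] Q1[of n] E
    by (simp add: power2_eq_square abs_of_pos frac_le)
qed (use gauss_binomial_eq_0 in \<open>auto simp: not_le\<close>)

text \<open>Tannery's theorem passes to the limit in the finite identity, separately for the indices
  \<open>m\<close> and \<open>- m - 1\<close>. The conclusion is an unordered sum so that products
  of two such series can be rearranged freely.\<close>

theorem jacobi_triple_product:
  assumes p: "0 < p" "p < 1" and a: "a \<noteq> 0"
  shows "(jtp_term p a has_sum qpoch p p * theta a p) UNIV"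
proof -
  define E where "E = qpoch p p"
  have E: "E > 0" unfolding E_def by (rule qpoch_pos) (use p in auto)
  \<comment> \<open>Extension by 0 turns the finite sums into series over all \<open>m\<close>. The
    guard in \<open>c2\<close> also masks truncated subtraction: for \<open>m \<ge> n\<close> the
    index \<open>n - Suc m\<close> would be 0, with coefficient 1.\<close>
  define c1 where "c1 m n = (if m \<le> n then gauss_binomial p (2 * n) (n + m) else 0)" for m n
  define c2 where "c2 m n = (if m < n then gauss_binomial p (2 * n) (n - Suc m) else 0)" for m n
  have lim1: "(\<lambda>n. c1 m n) \<longlonglongrightarrow> 1 / E" for m
  proof -
    have "(\<lambda>n. gauss_binomial p (2 * n) (n + m)) \<longlonglongrightarrow> 1 / E"
      unfolding E_def
      by (rule gauss_binomial_limit[OF p, of m])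
         (auto intro: filterlim_minus_const_nat_at_top filterlim_at_top_mono[OF filterlim_ident
             always_eventually])
    moreover have "eventually (\<lambda>n. gauss_binomial p (2 * n) (n + m) = c1 m n) sequentially"
      using eventually_ge_at_top[of m] by eventually_elim (simp add: c1_def)
    ultimately show ?thesis by (rule Lim_transform_eventually)
  qed
  have lim2: "(\<lambda>n. c2 m n) \<longlonglongrightarrow> 1 / E" for m
  proof -
    have "(\<lambda>n. gauss_binomial p (2 * n) (n - Suc m)) \<longlonglongrightarrow> 1 / E"
      unfolding E_def
      by (rule gauss_binomial_limit[OF p, of 0])
         (auto intro: filterlim_minus_const_nat_at_top filterlim_at_top_mono[OF filterlim_ident
             always_eventually])
    moreover have "eventually (\<lambda>n. gauss_binomial p (2 * n) (n - Suc m) = c2 m n) sequentially"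
      using eventually_gt_at_top[of m] by eventually_elim (simp add: c2_def)
    ultimately show ?thesis by (rule Lim_transform_eventually)
  qed
  have tannery: "(\<lambda>n. \<Sum>m. c m n * f m) \<longlonglongrightarrow> (\<Sum>m. 1 / E * f m)"
    if "\<And>m. (\<lambda>n. c m n) \<longlonglongrightarrow> 1 / E" "\<And>m n. \<bar>c m n\<bar> \<le> 1 / E\<^sup>2" "summable (\<lambda>m. norm (f m))"
    for c :: "nat \<Rightarrow> nat \<Rightarrow> real" and f
  proof -
    have lim: "(\<lambda>n. c m n * f m) \<longlonglongrightarrow> 1 / E * f m" for m
      using that(1) by (rule tendsto_mult_right)
    have sm: "summable (\<lambda>m. 1 / E\<^sup>2 * norm (f m))"
      using that(3) by (rule summable_mult)
    have bd: "eventually (\<lambda>(m, n). norm (c m n * f m) \<le> 1 / E\<^sup>2 *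
        norm (f m)) (at_top \<times>\<^sub>F sequentially)"
      using mult_right_mono[OF that(2) abs_ge_zero[of "f m" for m]]
      by (intro always_eventually) (auto simp: abs_mult)
    show ?thesis
      using tannerys_theorem[OF lim bd sm sequentially_bot] by blast
  qed
  have E2: "1 / E\<^sup>2 \<ge> 0" by simp
  have T1: "(\<lambda>n. \<Sum>m. c1 m n * jtp_term p a (int m)) \<longlonglongrightarrow> (\<Sum>m. 1 / E * jtp_term p a (int m))"
    using gauss_binomial_bound[OF p] E2
    by (intro tannery lim1 summable_jtp_term p) (auto simp: c1_def E_def)
  have T2: "(\<lambda>n. \<Sum>m. c2 m n * jtp_term p a (- int m
      - 1)) \<longlonglongrightarrow> (\<Sum>m. 1 / E * jtp_term p a (- int m - 1))"
    using gauss_binomial_bound[OF p] E2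
    by (intro tannery lim2 summable_jtp_term p) (auto simp: c2_def E_def)
  have fin: "(\<Sum>m. c1 m n * jtp_term p a (int m)) + (\<Sum>m. c2 m n * jtp_term p a (- int m - 1))
     = (\<Prod>i<n. 1 - a * p ^ i) * (\<Prod>i<n. 1 - p / a * p ^ i)" for n
  proof -
    let ?g = "\<lambda>k. gauss_binomial p (2 * n) k * jtp_term p a (int k - int n)"
    have "(\<Sum>m. c1 m n * jtp_term p a (int m)) = (\<Sum>m\<le>n. c1 m n * jtp_term p a (int m))"
      by (rule suminf_finite) (auto simp: c1_def)
    also have "\<dots> = (\<Sum>k\<in>{n..2 * n}. ?g k)"
      by (rule sum.reindex_bij_witness[of _ "\<lambda>k. k - n" "\<lambda>m. n + m"]) (auto simp: c1_def)
    finally have 1: "(\<Sum>m. c1 m n * jtp_term p a (int m)) = (\<Sum>k\<in>{n..2 * n}. ?g k)" .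
    have "(\<Sum>m. c2 m n * jtp_term p a (- int m - 1)) = (\<Sum>m<n. c2 m n * jtp_term p a (- int m - 1))"
      by (rule suminf_finite) (auto simp: c2_def)
    also have "\<dots> = (\<Sum>k<n. ?g k)"
      by (rule sum.reindex_bij_witness[of _ "\<lambda>k. n - Suc k" "\<lambda>m. n - Suc m"])
         (auto simp: c2_def of_nat_diff intro!: arg_cong[of _ _ "jtp_term p a"])
    finally have 2: "(\<Sum>m. c2 m n * jtp_term p a (- int m - 1)) = (\<Sum>k<n. ?g k)" .
    have "{..2 * n} = {..<n} \<union> {n..2 * n}" by auto
    then have "(\<Sum>k\<le>2 * n. ?g k) = (\<Sum>k<n. ?g k) + (\<Sum>k\<in>{n..2 * n}. ?g k)"
      by (simp only:) (subst sum.union_disjoint, auto)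
    then show ?thesis
      unfolding 1 2 finite_jacobi_triple_product[OF p(1) a] by simp
  qed
  have "(\<lambda>n. (\<Prod>i<n. 1 - a * p ^ i) * (\<Prod>i<n. 1 - p / a * p ^ i)) \<longlonglongrightarrow> theta a p"
    unfolding theta_def by (intro tendsto_intros qpoch_LIMSEQ p)
  with tendsto_add[OF T1 T2, unfolded fin]
  have "theta a p = (\<Sum>m. 1 / E * jtp_term p a (int m)) + (\<Sum>m. 1 / E * jtp_term p a (- int m - 1))"
    by (rule LIMSEQ_unique[rotated])
  also have "\<dots> = 1 / E * ((\<Sum>m. jtp_term p a (int m)) + (\<Sum>m. jtp_term p a (- int m - 1)))"
    using summable_jtp_term[OF p, THEN summable_norm_cancel]
    by (simp add: suminf_divide add_divide_distrib)
  finally have "E * theta a p = (\<Sum>m. jtp_term p a (int m)) + (\<Sum>m. jtp_term p a (- int m - 1))"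
    using E by (simp add: field_simps)
  then show ?thesis
    using has_sum_int_split[OF summable_jtp_term[OF p]] by (simp add: E_def)
qed

section \<open>The three-term relation\<close>

text \<open>Unordered summability of reals is absolute, so the family of products is summable over
  all pairs; the iterated sum then determines the value.\<close>

lemma has_sum_times:
  fixes f :: "'a \<Rightarrow> real" and g :: "'b \<Rightarrow> real"
  assumes f: "(f has_sum a) A" and g: "(g has_sum b) B"
  shows "((\<lambda>(x, y). f x * g y) has_sum a * b) (A \<times> B)"
proof (rule has_sum_SigmaI)
  show "((\<lambda>y. case (x, y) of (x, y) \<Rightarrow> f x * g y) has_sum f x * b) B" for x
    using has_sum_cmult_right[OF g] by simp
  show "((\<lambda>x. f x * b) has_sum a * b) A"
    using has_sum_cmult_left[OF f] by simp
  have "(\<lambda>x. norm (f x)) summable_on A" "(\<lambda>x. norm (g x)) summable_on B"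
    using f g has_sum_imp_summable summable_on_iff_abs_summable_on_real by blast+
  then have "(\<lambda>z. norm (case z of (x, y) \<Rightarrow> f x * g y)) summable_on A \<times> B"
    by (subst Infinite_Sum.abs_summable_on_Sigma_iff)
       (auto simp: abs_mult infsum_cmult_right' intro!: summable_on_cmult_left
           summable_on_cmult_right)
  then show "(\<lambda>(x, y). f x * g y) summable_on A \<times> B"
    by (rule abs_summable_summable)
qed

text \<open>In the product of the two bilateral series, the pairs \<open>(m, n)\<close> are split by
  the parity of \<open>m + n\<close>. On each class the coordinates \<open>k\<close>,
  \<open>l\<close> diagonalise the quadratic exponent, so the sum factors: one class gives
  \<open>G x * F y\<close>, the other \<open>F x * G y\<close>. The constant
  \<open>c / E ^ 2\<close> is absorbed into \<open>A\<close>.\<close>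

lemma theta_product_decomposition:
  assumes p: "0 < p" "p < 1" and c: "c \<noteq> 0"
  obtains A B :: "real \<Rightarrow> real" where
    "\<And>x y. x \<noteq> 0 \<Longrightarrow> y \<noteq> 0 \<Longrightarrow> theta (c * x * y) p * theta (x / y) p = x * (A x * B y - A y * B x)"
proof -
  define E where "E = qpoch p p"
  have E: "E > 0" unfolding E_def by (rule qpoch_pos) (use p in auto)
  define f where "f x l = p powi (l * l) * (c * x\<^sup>2) powi l" for x l
  define g where "g x l = p powi (l * l + l) * (c * x\<^sup>2) powi l" for x l
  define F where "F x = infsum (f x) UNIV" for x
  define G where "G x = infsum (g x) UNIV" for x
  have p2: "0 < p\<^sup>2" "p\<^sup>2 < 1" using p by (auto simp: power_less_one_iff)
  \<comment> \<open>So \<open>f x\<close> and \<open>g x\<close> are triple product series in base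
    \<open>p ^ 2\<close>, for \<open>e = 1\<close> and \<open>e = 2\<close>; this supplies their
    summability.\<close>
  have jt: "jtp_term (p\<^sup>2) (- (p powi e * (c * x\<^sup>2))) l = p powi (l * l - l + e *
      l) * (c * x\<^sup>2) powi l" for x l e
  proof -
    have "even (l * (l - 1))" by simp
    then have "2 * (l * (l - 1) div 2) = l * l - l" by (simp add: algebra_simps)
    then have "(p\<^sup>2) powi (l * (l - 1) div 2) = p powi (l * l - l)"
      by (metis power_int_mult power_int_numeral)
    then show ?thesis
      using p by (simp add: jtp_term_def power_int_mult_distrib power_int_mult power_int_add
          mult.assoc)
  qed
  have f: "(f x has_sum F x) UNIV" if "x \<noteq> 0" for x
  proof -
    have "(jtp_term (p\<^sup>2) (- (p powi 1 * (c * x\<^sup>2))) summable_on UNIV)"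
      using jacobi_triple_product[OF p2, of "- (p powi 1 * (c * x\<^sup>2))"] that c p
      by (auto simp: summable_on_def)
    then have "f x summable_on UNIV" unfolding jt f_def by simp
    then show ?thesis unfolding F_def by (rule has_sum_infsum)
  qed
  have g: "(g x has_sum G x) UNIV" if "x \<noteq> 0" for x
  proof -
    have "(jtp_term (p\<^sup>2) (- (p powi 2 * (c * x\<^sup>2))) summable_on UNIV)"
      using jacobi_triple_product[OF p2, of "- (p powi 2 * (c * x\<^sup>2))"] that c p
      by (auto simp: summable_on_def)
    then have "g x summable_on UNIV" unfolding jt g_def by (simp add: add.commute)
    then show ?thesis unfolding G_def by (rule has_sum_infsum)
  qed
  have powers: "z powi (k + l) * w powi (k - l) = (z * w) powi k * (z / w) powi l"
    if "z \<noteq> 0" "w \<noteq> 0" for z w :: real and k l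
    using that by (simp add: power_int_add power_int_diff power_int_mult_distrib
        power_int_divide_distrib)
  have main: "E\<^sup>2 * (theta (c * x * y) p * theta (x / y) p) = c * x * (x * G x * F y - y *
      G y * F x)"
    if xy: "x \<noteq> 0" "y \<noteq> 0" for x y
  proof -
    define h where "h = (\<lambda>(m, n). jtp_term p (c * x * y) m * jtp_term p (x / y) n)"
    have h: "(h has_sum (E * theta (c * x * y) p) * (E * theta (x / y) p)) UNIV"
      unfolding h_def E_def UNIV_Times_UNIV[symmetric] using xy c
      by (intro has_sum_times jacobi_triple_product p) auto
    have tri: "m * (m - 1) div 2 + n * (n - 1) div 2 = r"
      if "m * (m - 1) + n * (n - 1) = 2 * r" for m n r :: int
    proof -
      have "2 * (m * (m - 1) div 2) = m * (m - 1)" "2 * (n * (n - 1) div 2) = n * (n - 1)"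
        by (rule dvd_mult_div_cancel, simp)+
      then show ?thesis using that by linarith
    qed
    \<comment> \<open>Split the double series according to the parity of \<open>m + n\<close>.\<close>
    have he: "h (k + l, k - l) = c * x\<^sup>2 * g x (k - 1) * f y l" for k l
    proof -
      have "(k + l) * (k + l - 1) div 2 + (k - l) * (k - l - 1) div 2 = k * k - k + l * l"
        by (rule tri) (simp add: algebra_simps)
      then have "h (k + l, k - l) = p powi (k * k - k + l * l) * ((- (c * x * y)) powi (k + l) *
          (- (x / y)) powi (k - l))"
        using p by (simp add: h_def jtp_term_def power_int_add[symmetric] mult_ac)
      also have "(- (c * x * y)) powi (k + l) * (- (x / y)) powi (k - l) = (c *
          x\<^sup>2) powi k * (c * y\<^sup>2) powi l"
        using xy c by (subst powers) (auto simp: power2_eq_square field_simps)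
      finally show ?thesis
        using p xy c by (simp add: f_def g_def power_int_add power_int_diff field_simps)
    qed
    have ho: "h (k + l + 1, k - l) = - (c * x * y) * f x k * g y l" for k l
    proof -
      have "(k + l + 1) * (k + l + 1 - 1) div 2 + (k - l) * (k - l - 1) div 2 = k * k + (l * l + l)"
        by (rule tri) (simp add: algebra_simps)
      then have "h (k + l + 1, k - l) = p powi (k * k + (l * l + l)) * ((- (c * x * y)) powi (k
          + l + 1) * (- (x / y)) powi (k - l))"
        using p by (simp add: h_def jtp_term_def power_int_add[symmetric] mult_ac)
      also have "(- (c * x * y)) powi (k + l + 1) * (- (x / y)) powi (k - l) = - (c * x * y) *
          ((c * x\<^sup>2) powi k * (c * y\<^sup>2) powi l)"
        using xy c powers[of "- (c * x * y)" "- (x / y)" k l]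
        by (simp add: power_int_add[of _ "k + l"] power2_eq_square mult_ac)
      finally show ?thesis
        using p xy c by (simp add: f_def g_def power_int_add field_simps)
    qed
    \<comment> \<open>In \<open>he\<close> the exponent of \<open>p\<close> contains
      \<open>k * k - k\<close>, which is \<open>l * l + l\<close> at \<open>l = k - 1\<close>; hence
      \<open>g\<close> occurs shifted by one, which leaves a sum over all integers
      unchanged.\<close>
    have g1: "((\<lambda>k. g x (k - 1)) has_sum G x) UNIV"
      using g[OF xy(1)] by (subst (asm) has_sum_reindex_bij_witness[of _ "\<lambda>k. k
          - 1" "\<lambda>k. k + 1" UNIV "\<lambda>k. g x (k - 1)"]) auto
    have "((\<lambda>(k, l). h (k + l, k - l)) has_sum c * x\<^sup>2 * (G x * F y)) (UNIV \<times> UNIV)"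
      using has_sum_cmult_right[OF has_sum_times[OF g1 f[OF xy(2)]], of "c * x\<^sup>2"]
      unfolding he by (simp add: case_prod_unfold mult_ac)
    then have even: "(h has_sum c * x\<^sup>2 * (G x * F y)) {(m, n). even (m + n)}"
      by (subst (asm) has_sum_reindex_bij_witness[of _ "\<lambda>(m, n). ((m + n) div 2, (m - n) div 2)"
            "\<lambda>(k, l). (k + l, k - l)" "{(m, n). even (m + n)}" h]) (auto, presburger+)
    have "((\<lambda>(k, l). h (k + l + 1, k - l)) has_sum - (c * x * y) * (F x * G y)) (UNIV \<times> UNIV)"
      using has_sum_cmult_right[OF has_sum_times[OF f[OF xy(1)] g[OF xy(2)]], of "- (c * x * y)"]
      unfolding ho by (simp add: case_prod_unfold mult_ac)
    then have odd: "(h has_sum - (c * x * y) * (F x * G y)) {(m, n). odd (m + n)}"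
      by (subst (asm) has_sum_reindex_bij_witness[of _ "\<lambda>(m, n). ((m + n - 1) div 2, (m
          - n - 1) div 2)"
            "\<lambda>(k, l). (k + l + 1, k - l)" "{(m, n). odd (m + n)}" h]) (auto, presburger+)
    have "{(m, n). even (m + n)} \<union> {(m, n). odd (m + n)} = (UNIV :: (int \<times> int) set)" by auto
    with has_sum_Un_disjoint[OF even odd]
    have "(h has_sum c * x\<^sup>2 * (G x * F y) + - (c * x * y) * (F x * G y)) UNIV"
      by (simp add: disjoint_iff)
    from has_sum_unique[OF h this] show ?thesis
      by (simp add: power2_eq_square algebra_simps)
  qed
  show ?thesis
  proof (rule that)
    fix x y :: real assume xy: "x \<noteq> 0" "y \<noteq> 0"
    show "theta (c * x * y) p * theta (x / y) p
      = x * ((c / E\<^sup>2 * x * G x) * F y - (c / E\<^sup>2 * y * G y) * F x)"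
      using main[OF xy] E by (simp add: field_simps)
  qed
qed

text \<open>The denominators cancel the prefactors \<open>x\<close> of the decomposition, so each
  summand becomes a product of two 2 by 2 minors of the matrix with columns \<open>(A, B)\<close> at
  \<open>x\<close>, \<open>y\<close>, \<open>u\<close>, \<open>v\<close>.\<close>

lemma theta_three_term:
  assumes "0 < p" "p < 1" and nz: "c \<noteq> 0" "x \<noteq> 0" "y \<noteq> 0" "u \<noteq> 0" "v \<noteq> 0"
  shows "theta (c * x * y) p * theta (x / y) p * (theta (c * u * v) p * theta (u / v) p) / (x * u)
       - theta (c * x * u) p * theta (x / u) p * (theta (c * y * v) p * theta (y / v) p) / (x * y)
       + theta (c * x * v) p * theta (x / v) p * (theta (c * y * u) p * theta (y / u) p) / (x *
           y) = 0"
proof -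
  obtain A B where AB: "\<And>x y. x \<noteq> 0 \<Longrightarrow> y \<noteq> 0 \<Longrightarrow>
      theta (c * x * y) p * theta (x / y) p = x * (A x * B y - A y * B x)"
    using theta_product_decomposition[OF assms(1-3)] by blast
  show ?thesis
    using nz by (simp add: AB) (simp add: algebra_simps) \<comment> \<open>the Pluecker relation\<close>
qed

section \<open>Theta values at torsion points\<close>

text \<open>
  With \<open>q = w\<^sup>4\<^sup>8\<close> this is \<open>\<theta>(s q\<^sup>k; q\<^sup>2\<^sup>4)\<close>, \<open>s = \<plusminus>1\<close>, times \<open>q\<close> to the power
  \<open>k (k - 24) / 48\<close>. The prefactor removes all powers of \<open>q\<close> from the functional equations
  and from the three-term relation.
\<close>

definition ntheta :: "real \<Rightarrow> real \<Rightarrow> int \<Rightarrow> real" where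
  "ntheta w s k = w powi (k * (k - 24)) * theta (s * w powi (48 * k)) (w ^ 1152)"

text \<open>Signs are encoded by \<open>s * s = 1\<close>, so that the arguments
  \<open>q ^ k\<close> and \<open>- (q ^ k)\<close> are treated together.\<close>

lemma involution_inverse:
  fixes s :: real
  assumes "s * s = 1"
  shows "s \<noteq> 0" "1 / s = s"
proof -
  show "s \<noteq> 0" using assms by auto
  then show "1 / s = s" using assms by (simp add: nonzero_divide_eq_eq)
qed

context
  fixes w :: real
  assumes w: "0 < w" "w < 1"
begin

lemma nome: "0 < w ^ 1152" "w ^ 1152 < 1"
  using w by (auto simp: power_less_one_iff)

lemma ntheta_shift:
  assumes "s * s = 1"
  shows "ntheta w s (k + 24) = - s * ntheta w s k"
proof -
  let ?a = "s * w powi (48 * k)"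
  note s = involution_inverse[OF assms]
  have e1: "s * w powi (48 * (k + 24)) = w ^ 1152 * ?a"
    using w by (simp add: power_int_add algebra_simps)
  have e2: "theta (w ^ 1152 * ?a) (w ^ 1152) = - theta ?a (w ^ 1152) / ?a"
    using w s(1) by (intro theta_shift nome) auto
  have e3: "w powi ((k + 24) * (k + 24 - 24)) = w powi (k * (k - 24)) * w powi (48 * k)"
    using w by (simp add: power_int_add[symmetric] algebra_simps)
  have "ntheta w s (k + 24) = - (1 / s) * ntheta w s k"
    unfolding ntheta_def e1 e2 e3 using w s(1) by simp
  then show ?thesis by (simp only: s)
qed

lemma ntheta_shift_multiple:
  assumes "s * s = 1"
  shows "ntheta w s (k + 24 * int j) = (- s) ^ j * ntheta w s k"
proof (induction j)
  case (Suc j)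
  have "ntheta w s (k + 24 * int (Suc j)) = ntheta w s ((k + 24 * int j) + 24)"
    by (simp add: algebra_simps)
  then show ?case using ntheta_shift[OF assms] Suc by simp
qed simp

text \<open>Together with \<open>ntheta_shift\<close>: for \<open>s = 1\<close> the function of
  \<open>k\<close> is odd and changes sign under a shift by 24; for \<open>s = - 1\<close> it is
  even with period 24. Both are invariant under \<open>k \<mapsto> 24 - k\<close>.\<close>

lemma ntheta_minus:
  assumes "s * s = 1"
  shows "ntheta w s (- k) = - s * ntheta w s k"
proof -
  let ?a = "s * w powi (48 * k)"
  note s = involution_inverse[OF assms]
  have "1 / ?a = (1 / s) * w powi (48 * (- k))"
    by (simp add: power_int_minus divide_inverse)
  then have e1: "s * w powi (48 * (- k)) = 1 / ?a"
    by (simp only: s)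
  have e2: "theta (1 / ?a) (w ^ 1152) = - theta ?a (w ^ 1152) / ?a"
    using w s(1) by (intro theta_inverse nome) auto
  have e3: "w powi ((- k) * (- k - 24)) = w powi (k * (k - 24)) * w powi (48 * k)"
    using w by (simp add: power_int_add[symmetric] algebra_simps)
  have "ntheta w s (- k) = - (1 / s) * ntheta w s k"
    unfolding ntheta_def e1 e2 e3 using w s(1) by simp
  then show ?thesis by (simp only: s)
qed

text \<open>The exponent of \<open>w\<close> on the right is a constant in \<open>c\<close> plus a
  function of \<open>x\<close> plus the same function of \<open>y\<close>. Pairing four points
  differently therefore leaves the product of two such powers unchanged, and a common power factors
  out of the three-term relation.\<close>

lemma ntheta_pair:
  assumes "sx * sx = 1" "sy * sy = 1"
  shows "sx * (ntheta w (sc * sx * sy) (c + x + y) * ntheta w (sx * sy) (x - y))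
   = w powi (c * c + 2 * c * (x + y) + 2 * (x * x) + 2 * (y * y) - 24 * c) *
     (theta (sc * w powi (48 * c) * (sx * w powi (48 * x)) * (sy * w powi (48 * y))) (w ^ 1152) *
      theta ((sx * w powi (48 * x)) / (sy * w powi (48 * y))) (w ^ 1152) / (sx * w powi (48 * x)))"
proof -
  note sx = involution_inverse[OF assms(1)] and sy = involution_inverse[OF assms(2)]
  let ?X = "sx * w powi (48 * x)" and ?Y = "sy * w powi (48 * y)"
  have e1: "sc * sx * sy * w powi (48 * (c + x + y)) = sc * w powi (48 * c) * ?X * ?Y"
    using w by (simp add: power_int_add distrib_left mult_ac)
  have "sx * (1 / sy) * w powi (48 * (x - y)) = ?X / ?Y"
    using w by (simp add: power_int_diff right_diff_distrib)
  then have e2: "sx * sy * w powi (48 * (x - y)) = ?X / ?Y"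
    by (simp only: sy)
  have e3: "w powi (c * c + 2 * c * (x + y) + 2 * (x * x) + 2 * (y * y) - 24 * c)
      = w powi ((c + x + y) * (c + x + y - 24)) * w powi ((x - y) * (x - y - 24)) * w powi (48 * x)"
    using w by (simp add: power_int_add[symmetric] algebra_simps)
  have "(1 / sx) * (ntheta w (sc * sx * sy) (c + x + y) * ntheta w (sx * sy) (x - y))
   = w powi (c * c + 2 * c * (x + y) + 2 * (x * x) + 2 * (y * y) - 24 * c) *
     (theta (sc * w powi (48 * c) * ?X * ?Y) (w ^ 1152) * theta (?X / ?Y) (w ^ 1152) / ?X)"
    unfolding ntheta_def e1 e2 e3 using w sx(1) by simp
  then show ?thesis by (simp only: sx)
qed

lemma ntheta_three_term:
  assumes s: "sc * sc = 1" "sx * sx = 1" "sy * sy = 1" "su * su = 1" "sv * sv = 1"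
  shows "(sx * (ntheta w (sc * sx * sy) (c + x + y) * ntheta w (sx * sy) (x - y))) *
         (su * (ntheta w (sc * su * sv) (c + u + v) * ntheta w (su * sv) (u - v)))
       - (sx * (ntheta w (sc * sx * su) (c + x + u) * ntheta w (sx * su) (x - u))) *
         (sy * (ntheta w (sc * sy * sv) (c + y + v) * ntheta w (sy * sv) (y - v)))
       + (sx * (ntheta w (sc * sx * sv) (c + x + v) * ntheta w (sx * sv) (x - v))) *
         (sy * (ntheta w (sc * sy * su) (c + y + u) * ntheta w (sy * su) (y - u))) = 0"
proof -
  define C where "C = sc * w powi (48 * c)"
  define X where "X = sx * w powi (48 * x)"
  define Y where "Y = sy * w powi (48 * y)"
  define U where "U = su * w powi (48 * u)"
  define V where "V = sv * w powi (48 * v)"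
  let ?e = "\<lambda>x y. c * c + 2 * c * (x + y) + 2 * (x * x) + 2 * (y * y) - 24 * c"
  have nz: "C \<noteq> 0" "X \<noteq> 0" "Y \<noteq> 0" "U \<noteq> 0" "V \<noteq> 0"
    unfolding C_def X_def Y_def U_def V_def using w s by auto
  have e: "w powi ?e x u * w powi ?e y v = w powi ?e x y * w powi ?e u v"
      "w powi ?e x v * w powi ?e y u = w powi ?e x y * w powi ?e u v"
    using w by (simp_all add: power_int_add[symmetric] algebra_simps)
  have regroup: "(a1 * (b1 / d1)) * (a2 * (b2 / d2)) = (a1 * a2) * (b1 * b2 / (d1 * d2))"
    for a1 b1 d1 a2 b2 d2 :: real by simp
  show ?thesis
    unfolding ntheta_pair[OF s(2,3)] ntheta_pair[OF s(4,5)] ntheta_pair[OF s(2,4)]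
      ntheta_pair[OF s(3,5)] ntheta_pair[OF s(2,5)] ntheta_pair[OF s(3,4)]
      C_def[symmetric] X_def[symmetric] Y_def[symmetric] U_def[symmetric] V_def[symmetric]
      regroup e
    using theta_three_term[OF nome nz]
    by (simp only: right_diff_distrib[symmetric] distrib_left[symmetric] mult_zero_right)
qed

text \<open>
  The twelve instances and their cofactors were found by linear algebra on monomials in the values
  \<open>t k\<close>, \<open>n k\<close>, which succeeded after multiplication with the auxiliary factor \<open>t 8\<close>.
\<close>

lemma ntheta_master_identity:
  fixes a :: nat and t n :: "int \<Rightarrow> real"
  assumes a: "odd a"
  defines "t \<equiv> \<lambda>k. ntheta w 1 (int a * k)" and "n \<equiv> \<lambda>k. ntheta w (- 1) (int a * k)"
  shows "t 8 * (n 1 * n 7 * n 11 *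
           (t 7 * (t 2 * n 2) * (t 9 * n 9) - t 11 * (t 3 * n 3) * (t 4 * n 4))
         - t 2 * t 10 * t 5 * t 9 * t 4 * (t 4 * n 4) * t 6) = 0"
proof -
  have neg: "t (- k) = - t k" "n (- k) = n k" for k
    using ntheta_minus[of 1 "int a * k"] ntheta_minus[of "- 1" "int a * k"]
    by (simp_all add: t_def n_def)
  \<comment> \<open>Oddness of \<open>a\<close> enters here: the shift by \<open>24 * a\<close>
    multiplies \<open>t\<close> by \<open>(- 1) ^ a = - 1\<close>, which cancels the sign from
    \<open>t (- k) = - t k\<close>.\<close>
  have refl: "t (24 - k) = t k" "n (24 - k) = n k" for k
  proof -
    have e: "int a * (24 - k) = - (int a * k) + 24 * int a" by (simp add: algebra_simps)
    show "t (24 - k) = t k" "n (24 - k) = n k"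
      using a ntheta_shift_multiple[of 1 "- (int a * k)" a]
        ntheta_shift_multiple[of "- 1" "- (int a * k)" a]
      by (simp_all add: t_def n_def e ntheta_minus)
  qed
  have sym: "t (- 1) = - t 1" "n (- 1) = n 1"
    "t (- numeral k) = - t (numeral k)" "n (- numeral k) = n (numeral k)"
    "t 13 = t 11" "t 14 = t 10" "t 15 = t 9" "t 16 = t 8" "t 17 = t 7" "t 18 = t 6"
    "t 19 = t 5" "t 20 = t 4" "t 21 = t 3" "t 22 = t 2" "t 23 = t 1"
    "n 13 = n 11" "n 14 = n 10" "n 15 = n 9" "n 16 = n 8" "n 17 = n 7" "n 18 = n 6"
    "n 19 = n 5" "n 20 = n 4" "n 21 = n 3" "n 22 = n 2" "n 23 = n 1" for k
    using refl[of 11] refl[of 10] refl[of 9] refl[of 8] refl[of 7] refl[of 6]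
      refl[of 5] refl[of 4] refl[of 3] refl[of 2] refl[of 1] by (simp_all add: neg)
  define f where "f s k = ntheta w s (int a * k)" for s k
  have f: "f 1 k = t k" "f (- 1) k = n k" for k
    by (simp_all add: f_def t_def n_def)
  \<comment> \<open>Multiplication by \<open>a\<close> is linear in the indices, so one choice of
    \<open>c\<close>, \<open>x\<close>, \<open>y\<close>, \<open>u\<close>, \<open>v\<close> serves
    all conjugates.\<close>
  have W: "(sx * (f (sc * sx * sy) (c + x + y) * f (sx * sy) (x - y))) *
         (su * (f (sc * su * sv) (c + u + v) * f (su * sv) (u - v)))
       - (sx * (f (sc * sx * su) (c + x + u) * f (sx * su) (x - u))) *
         (sy * (f (sc * sy * sv) (c + y + v) * f (sy * sv) (y - v)))
       + (sx * (f (sc * sx * sv) (c + x + v) * f (sx * sv) (x - v))) *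
         (sy * (f (sc * sy * su) (c + y + u) * f (sy * su) (y - u))) = 0"
    if "sc * sc = 1" "sx * sx = 1" "sy * sy = 1" "su * su = 1" "sv * sv = 1"
    for sc sx sy su sv :: real and c x y u v :: int
    using ntheta_three_term[OF that, of "int a * c" "int a * x" "int a * y" "int a * u" "int a * v"]
    unfolding f_def distrib_left right_diff_distrib .
  note sym = sym f
  \<comment> \<open>The arguments of \<open>W\<close> are the signs \<open>sc\<close>,
    \<open>sx\<close>, \<open>sy\<close>, \<open>su\<close>, \<open>sv\<close>, then the indices
    \<open>c\<close>, \<open>x\<close>, \<open>y\<close>, \<open>u\<close>, \<open>v\<close>. The
    rules \<open>sym\<close> fold all resulting indices into the range from 0 to 12.\<close>
  have w1: "t 3 * t 4 * n 5 * n 10 + t 6 * t 11 * n 4 * n 5 - t 9 * t 10 * n 1 * n 8 = 0"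
    using W[of 1 1 1 1 "-1" 1 3 0 9 4] by (simp add: sym mult_ac)
  have w2: "t 6 * t 8 * n 0 * n 4 + t 3 * t 7 * n 9 * n 11 - t 9 * t 11 * n 3 * n 7 = 0"
    using W[of 1 1 1 1 "-1" 2 6 0 9 9] by (simp add: sym mult_ac)
  have w3: "t 4 * t 5 * t 9 * t 10 + n 0 * n 1 * n 5 * n 10 - n 4 * n 5 * n 9 * n 10 = 0"
    using W[of 1 1 1 "-1" "-1" 1 4 0 0 9] by (simp add: sym mult_ac)
  have w4: "t 6 * t 11 * n 3 * n 4 - t 5 * t 12 * n 2 * n 3 - t 1 * t 6 * n 8 * n 9 = 0"
    using W[of 1 "-1" 1 "-1" "-1" 1 2 0 3 8] by (simp add: sym mult_ac)
  have w5: "t 2 * t 5 * t 7 * t 12 - t 1 * t 4 * t 6 * t 11 - t 1 * t 6 * t 8 * t 11 = 0"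
    using W[of 1 1 1 1 1 2 4 0 5 6] by (simp add: sym mult_ac)
  have w6: "t 2 * t 4 * t 8 * t 12 + n 1 * n 3 * n 7 * n 11 - n 1 * n 5 * n 9 * n 11 = 0"
    using W[of 1 1 1 "-1" "-1" 2 2 0 1 9] by (simp add: sym mult_ac)
  have w7: "t 4 * t 5 * t 9 * t 10 - t 2 * t 3 * t 7 * t 8 - t 2 * t 7 * t 11 * t 12 = 0"
    using W[of 1 1 1 1 1 1 2 0 4 11] by (simp add: sym mult_ac)
  have w8: "t 2 * t 3 * t 7 * t 8 + n 4 * n 5 * n 9 * n 10 - n 2 * n 7 * n 11 * n 12 = 0"
    using W[of 1 1 1 "-1" "-1" 1 2 0 4 11] by (simp add: sym mult_ac)
  have w9: "t 8 * t 9 * n 2 * n 7 + t 1 * t 6 * n 7 * n 8 - t 9 * t 10 * n 1 * n 8 = 0"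
    using W[of 1 1 1 1 "-1" 1 8 0 9 7] by (simp add: sym mult_ac)
  have w10: "t 4 * t 6 * n 4 * n 12 + t 3 * t 11 * n 3 * n 5 - t 7 * t 9 * n 1 * n 9 = 0"
    using W[of 1 1 1 1 "-1" 2 4 0 7 3] by (simp add: sym mult_ac)
  have w11: "t 1 * t 6 * n 2 * n 11 + t 2 * t 9 * n 5 * n 10 - t 3 * t 8 * n 4 * n 11 = 0"
    using W[of 1 1 1 1 "-1" 5 1 0 3 5] by (simp add: sym mult_ac)
  have w12: "t 2 * t 3 * n 2 * n 5 + t 1 * t 6 * n 1 * n 2 - t 3 * t 4 * n 1 * n 4 = 0"
    using W[of 1 1 1 1 "-1" 1 2 0 3 1] by (simp add: sym mult_ac)
  \<comment> \<open>Each cofactor is a monomial of degree five with coefficient 1 or -1, so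
    everything is homogeneous of degree nine; the combination produces twice the claim.\<close>
  have "2 * (t 8 * (n 1 * n 7 * n 11 *
           (t 7 * (t 2 * n 2) * (t 9 * n 9) - t 11 * (t 3 * n 3) * (t 4 * n 4))
         - t 2 * t 10 * t 5 * t 9 * t 4 * (t 4 * n 4) * t 6)) =
      - (t 2 * t 7 * n 1 * n 9 * n 11 * (t 3 * t 4 * n 5 * n 10 + t 6 * t 11 * n 4 * n 5 - t 9 *
          t 10 * n 1 * n 8)
      - t 2 * t 4 * n 1 * n 5 * n 10 * (t 6 * t 8 * n 0 * n 4 + t 3 * t 7 * n 9 * n 11 - t 9 *
          t 11 * n 3 * n 7)
      + t 2 * t 4 * t 6 * t 8 * n 4 * (t 4 * t 5 * t 9 * t 10 + n 0 * n 1 * n 5 * n 10 - n 4 *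
          n 5 * n 9 * n 10)
      - t 2 * t 7 * n 1 * n 7 * n 11 * (t 6 * t 11 * n 3 * n 4 - t 5 * t 12 * n 2 * n 3 - t 1 *
          t 6 * n 8 * n 9)
      - n 1 * n 2 * n 3 * n 7 * n 11 * (t 2 * t 5 * t 7 * t 12 - t 1 * t 4 * t 6 * t 11 - t 1 *
          t 6 * t 8 * t 11)
      + t 2 * t 6 * t 7 * t 11 * n 4 * (t 2 * t 4 * t 8 * t 12 + n 1 * n 3 * n 7 * n 11 - n 1 *
          n 5 * n 9 * n 11)
      + t 2 * t 4 * t 6 * t 8 * n 4 * (t 4 * t 5 * t 9 * t 10 - t 2 * t 3 * t 7 * t 8 - t 2 *
          t 7 * t 11 * t 12)
      + t 2 * t 4 * t 6 * t 8 * n 4 * (t 2 * t 3 * t 7 * t 8 + n 4 * n 5 * n 9 * n 10 - n 2 *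
          n 7 * n 11 * n 12)
      - t 2 * t 7 * n 1 * n 9 * n 11 * (t 8 * t 9 * n 2 * n 7 + t 1 * t 6 * n 7 * n 8 - t 9 *
          t 10 * n 1 * n 8)
      + t 2 * t 8 * n 2 * n 7 * n 11 * (t 4 * t 6 * n 4 * n 12 + t 3 * t 11 * n 3 * n 5 - t 7 *
          t 9 * n 1 * n 9)
      - t 4 * t 11 * n 1 * n 3 * n 7 * (t 1 * t 6 * n 2 * n 11 + t 2 * t 9 * n 5 * n 10 - t 3 *
          t 8 * n 4 * n 11)
      - t 8 * t 11 * n 3 * n 7 * n 11 * (t 2 * t 3 * n 2 * n 5 + t 1 * t 6 * n 1 * n 2 - t 3 *
          t 4 * n 1 * n 4))"
    by algebra
  also have "\<dots> = 0"
    unfolding w1 w2 w3 w4 w5 w6 w7 w8 w9 w10 w11 w12 by simp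
  finally show ?thesis by simp
qed

end

section \<open>Duplication within one base, and removal of the auxiliary factors\<close>

lemma theta_double:
  assumes "0 < r" "r < 1" "x \<noteq> 0"
  shows "theta (x\<^sup>2) (r\<^sup>2) =
    theta x (r\<^sup>2) * theta (- x) (r\<^sup>2) * theta (r / x) (r\<^sup>2) * theta (- (r / x)) (r\<^sup>2)"
proof -
  have r2: "0 < r\<^sup>2" using assms by simp
  have "theta (r * y) (r\<^sup>2) = theta (r / y) (r\<^sup>2)" if "y \<noteq> 0" for y
    using theta_reflect[OF r2, of "r * y"] that assms by (simp add: power2_eq_square)
  from this[of x] this[of "- x"] show ?thesis
    using theta_square[OF assms] theta_split[OF assms] theta_split[of r "- x"] assms
    by (simp add: mult_ac)
qed

text \<open>With \<open>r = w ^ 576\<close>, the square root of the nome, the argument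
  \<open>r / x\<close> belongs to the index \<open>12 - k\<close>. The factor \<open>w ^ 288\<close>
  balances the prefactors: the exponents of the four values on the right add up to
  \<open>2 * k * (2 * k - 24) - 288\<close>.\<close>

lemma ntheta_double:
  assumes w: "0 < w" "w < 1"
  shows "ntheta w 1 (2 * k) = w ^ 288 *
    (ntheta w 1 k * ntheta w (- 1) k * ntheta w 1 (12 - k) * ntheta w (- 1) (12 - k))"
proof -
  let ?x = "w powi (48 * k)" and ?r = "w ^ 576"
  have r: "0 < ?r" "?r < 1" "?x \<noteq> 0" using w by (auto simp: power_less_one_iff)
  have r2: "?r\<^sup>2 = w ^ 1152" by (simp flip: power_mult)
  have x2: "?x\<^sup>2 = w powi (48 * (2 * k))"
    using w by (simp add: power2_eq_square flip: power_int_add)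
  have rx: "?r / ?x = w powi (48 * (12 - k))"
    using w by (simp add: power_int_diff right_diff_distrib)
  have e: "w powi (2 * k * (2 * k - 24)) = w ^ 288 *
      (w powi (k * (k - 24)) * w powi (k * (k - 24)) *
       w powi ((12 - k) * (12 - k - 24)) * w powi ((12 - k) * (12 - k - 24)))"
  proof -
    have "w ^ 288 = w powi 288" by simp
    moreover have "w \<noteq> 0" using w by simp
    ultimately show ?thesis
      by (simp only: power_int_add[OF disjI1, symmetric] simp_thms) (simp add: algebra_simps)
  qed
  show ?thesis
    using theta_double[OF r] unfolding r2 x2 rx ntheta_def e by simp
qed

lemma ntheta_neg_pos:
  assumes w: "0 < w" "w < 1"
  shows "ntheta w (- 1) k > 0"
  unfolding ntheta_def using w by (intro mult_pos_pos theta_neg_pos nome) auto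

text \<open>Duplication expresses \<open>t 2 * t 10\<close> by eight values. Multiplying by
  \<open>n 1 * n 7 * n 11\<close> completes these eight on the right, and replacing them by
  \<open>t 2 * t 10\<close> brings the degrees 5 and 11 to the common degree 8 of the master
  identity. The multipliers are positive, hence cancel.\<close>

lemma ntheta_identity:
  fixes a :: nat and t n :: "int \<Rightarrow> real"
  assumes w: "0 < w" "w < 1" and a: "odd a"
  defines "t \<equiv> \<lambda>k. ntheta w 1 (int a * k)" and "n \<equiv> \<lambda>k. ntheta w (- 1) (int a * k)"
  assumes nz: "t 8 \<noteq> 0"
  shows "t 7 * (t 2 * n 2) * (t 9 * n 9) - t 11 * (t 3 * n 3) * (t 4 * n 4)
       = w ^ 576 * (t 1 * t 11 * t 7 * t 5 * t 9 * t 4 * t 6 * (t 5 * n 5) * (t 4 * n 4))"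
proof -
  obtain b where b: "a = 2 * b + 1" using a by (elim oddE)
  \<comment> \<open>Since \<open>a = 2 * b + 1\<close>, the indices \<open>a * (12 - k)\<close> and
    \<open>12 - a * k\<close> differ by \<open>24 * b\<close>, whence the sign. It disappears below
    because duplication is used for both \<open>t 2\<close> and \<open>t 10\<close>.\<close>
  have double: "t (2 * k) = (- 1) ^ b * w ^ 288 * (t k * n k * t (12 - k) * n (12 - k))" for k
  proof -
    have e: "int a * (12 - k) = 12 - int a * k + 24 * int b"
      by (simp add: b algebra_simps)
    have "t (12 - k) = (- 1) ^ b * ntheta w 1 (12 - int a * k)"
      unfolding t_def e by (subst ntheta_shift_multiple[OF w]) auto
    moreover have "n (12 - k) = ntheta w (- 1) (12 - int a * k)"
      unfolding n_def e by (subst ntheta_shift_multiple[OF w]) auto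
    moreover have "t (2 * k) = ntheta w 1 (2 * (int a * k))"
      by (simp add: t_def mult_ac)
    moreover have "(- 1) ^ b * ((- 1) ^ b * z) = z" for z :: real
      by (simp flip: mult.assoc power_add mult_2)
    ultimately show ?thesis
      unfolding ntheta_double[OF w] by (simp add: t_def n_def mult_ac)
  qed
  have "t 2 * t 10 = ((- 1) ^ b * (- 1) ^ b) * (w ^ 288 * w ^ 288) *
      (t 1 * n 1 * t 11 * n 11) * (t 5 * n 5 * t 7 * n 7)"
    using double[of 1] double[of 5] by (simp add: mult_ac)
  also have "(- 1) ^ b * (- 1) ^ b = (1 :: real)"
    by (simp flip: power_add mult_2)
  also have "w ^ 288 * w ^ 288 = w ^ 576" by (simp flip: power_add)
  finally have d: "t 2 * t 10 = w ^ 576 * (t 1 * n 1 * t 11 * n 11) * (t 5 * n 5 * t 7 *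
      n 7)" by simp
  have "n 1 * n 7 * n 11 * (t 7 * (t 2 * n 2) * (t 9 * n 9) - t 11 * (t 3 * n 3) * (t 4 * n 4))
      = (t 2 * t 10) * (t 5 * t 9 * t 4 * (t 4 * n 4) * t 6)"
    using ntheta_master_identity[OF w a] nz unfolding t_def[symmetric] n_def[symmetric]
    by (simp add: t_def n_def mult_ac)
  also have "\<dots> = n 1 * n 7 * n 11 *
      (w ^ 576 * (t 1 * t 11 * t 7 * t 5 * t 9 * t 4 * t 6 * (t 5 * n 5) * (t 4 * n 4)))"
    unfolding d by (simp add: mult_ac)
  finally have *: "n 1 * n 7 * n 11 * (t 7 * (t 2 * n 2) * (t 9 * n 9) - t 11 * (t 3 * n 3) *
      (t 4 * n 4))
      = n 1 * n 7 * n 11 *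
      (w ^ 576 * (t 1 * t 11 * t 7 * t 5 * t 9 * t 4 * t 6 * (t 5 * n 5) * (t 4 * n 4)))" .
  have "n 1 * n 7 * n 11 \<noteq> 0"
    unfolding n_def using ntheta_neg_pos[OF w] by (simp add: less_imp_neq[symmetric])
  with * show ?thesis by (metis mult_left_cancel)
qed

section \<open>The theta identities in base \<open>q\<^sup>4\<^sup>8\<close>\<close>

definition theta48 :: "real \<Rightarrow> nat \<Rightarrow> real" where
  "theta48 q r = theta (q ^ r) (q ^ 48)"

lemma theta48_pos:
  assumes "0 < q" "q < 1" "0 < r" "r < 48"
  shows "theta48 q r > 0"
  unfolding theta48_def using assms
  by (intro theta_pos) (auto simp: power_strict_decreasing power_less_one_iff)

lemma theta48_reflect:
  assumes "0 < q" "r \<le> 48"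
  shows "theta48 q (48 - r) = theta48 q r"
  using theta_reflect[of "q ^ 48" "q ^ r"] assms by (simp add: theta48_def power_diff)

lemma ntheta_of_nat:
  assumes w: "0 < w"
  shows "ntheta w s (int m) = w powi (int m * (int m - 24)) * theta (s *
      (w ^ 48) ^ m) ((w ^ 48) ^ 24)"
proof -
  have "w powi (48 * int m) = (w ^ 48) ^ m"
    by (simp add: power_int_mult)
  moreover have "w ^ 1152 = (w ^ 48) ^ 24" by (simp flip: power_mult)
  ultimately show ?thesis by (simp only: ntheta_def)
qed

text \<open>Splitting base \<open>q ^ 24\<close> gives the indices \<open>m\<close> and
  \<open>24 + m\<close> in base \<open>q ^ 48\<close>, and reflection turns the latter into
  \<open>24 - m\<close>. The offset \<open>24 * j\<close> contributes only a sign.\<close>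

lemma ntheta_unfold:
  assumes w: "0 < w" "w < 1" and m: "m \<le> 24"
  shows "ntheta w 1 (int m + 24 * int j)
       = (- 1) ^ j * w powi (int m * (int m - 24)) * (theta48 (w ^ 48) m * theta48 (w ^ 48) (24
           - m))"
proof -
  define q where "q = w ^ 48"
  have q: "0 < q" "q < 1" using w by (auto simp: q_def power_less_one_iff)
  have "theta (q ^ m) (q ^ 24) = theta (q ^ m) ((q ^ 24)\<^sup>2) * theta (q ^ 24 * q ^ m) ((q ^ 24)\<^sup>2)"
    using q by (intro theta_split) (auto simp: power_less_one_iff)
  also have "(q ^ 24)\<^sup>2 = q ^ 48" by (simp flip: power_mult)
  also have "q ^ 24 * q ^ m = q ^ (48 - (24 - m))" using m by (simp flip: power_add)
  finally have "theta (q ^ m) (q ^ 24) = theta48 q m * theta48 q (24 - m)"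
    using theta48_reflect[OF q(1), of "24 - m"] by (simp add: theta48_def)
  then show ?thesis
    by (simp add: ntheta_shift_multiple[OF w] ntheta_of_nat[OF w(1)] flip: q_def)
qed

text \<open>By \<open>theta_square\<close> the two signs merge into one theta at twice the index.
  Only the factor with \<open>s = 1\<close> changes sign under a shift, hence the single
  \<open>(- 1) ^ j\<close>. When \<open>2 * m\<close> exceeds 24, the applications reflect
  it.\<close>

lemma ntheta_pair_unfold:
  assumes w: "0 < w" "w < 1"
  shows "ntheta w 1 (int m + 24 * int j) * ntheta w (- 1) (int m + 24 * int j)
       = (- 1) ^ j * w powi (2 * (int m * (int m - 24))) * theta48 (w ^ 48) (2 * m)"
proof -
  define q where "q = w ^ 48"
  have q: "0 < q" "q < 1" using w by (auto simp: q_def power_less_one_iff)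
  have "theta (q ^ m) (q ^ 24) * theta (- (q ^ m)) (q ^ 24) = theta ((q ^ m)\<^sup>2) ((q ^ 24)\<^sup>2)"
    using q by (intro theta_square) (auto simp: power_less_one_iff)
  also have "(q ^ 24)\<^sup>2 = q ^ 48" by (simp flip: power_mult)
  also have "(q ^ m)\<^sup>2 = q ^ (2 * m)" by (simp add: power_even_eq)
  finally have *: "theta48 q (2 * m) = theta (q ^ m) (q ^ 24) * theta (- (q ^ m)) (q ^ 24)"
    by (simp add: theta48_def)
  have e: "w powi (2 * (int m * (int m - 24))) = w powi (int m * (int m - 24)) * w powi (int m *
      (int m - 24))"
    using w by (simp flip: power_int_add)
  show ?thesis
    by (simp add: ntheta_shift_multiple[OF w] ntheta_of_nat[OF w(1)] e * flip: q_def)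
qed

lemma ntheta_nonzero:
  assumes w: "0 < w" "w < 1" and m: "0 < m" "m < 24"
  shows "ntheta w 1 (int m + 24 * int j) \<noteq> 0"
proof -
  have "0 < w ^ 48" "w ^ 48 < 1" using w by (auto simp: power_less_one_iff)
  then have "theta48 (w ^ 48) m > 0" "theta48 (w ^ 48) (24 - m) > 0"
    using m by (auto intro!: theta48_pos)
  then show ?thesis using w m by (simp add: ntheta_unfold)
qed

text \<open>The case \<open>a = 1\<close> of \<open>ntheta_identity\<close>. In all four cases the
  indices \<open>a * k\<close> are written as \<open>m + 24 * j\<close> and unfolded to base
  \<open>q ^ 48\<close>.\<close>

lemma theta48_identity_i:
  assumes q: "0 < q" "q < 1"
  shows "(theta48 q 4 * theta48 q 7 * theta48 q 17 * theta48 q 18)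
       - q * (theta48 q 6 * theta48 q 8 * theta48 q 11 * theta48 q 13)
       = (theta48 q 1 * theta48 q 4 * theta48 q 5 * theta48 q 6 * theta48 q 7 * theta48 q 8 *
           theta48 q 9 * theta48 q 10 * theta48 q 11 * theta48 q 13 * theta48 q 15 *
           theta48 q 17 * theta48 q 18 * theta48 q 19 * theta48 q 20 * theta48 q 23)"
proof -
  define w where "w = root 48 q"
  have w: "0 < w" "w < 1" and qw: "w ^ 48 = q"
    using q by (auto simp: w_def real_root_pow_pos2)
  \<comment> \<open>\<open>W\<close> keeps the powers of \<open>w\<close> opaque while the thetas
    are rearranged. The exponents occurring in \<open>facts\<close> are \<open>m * (m - 24)\<close>,
    doubled in \<open>pairs\<close>; \<open>P\<close> adds them up.\<close>
  define W where "W e = w powi e" for e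
  have W: "W e * W f = W (e + f)" "q ^ d = W (48 * int d)" "w ^ 576 = W 576" for e f d
    using w by (simp_all add: W_def power_int_add power_int_mult flip: qw)
  note unf = ntheta_unfold[OF w, unfolded qw W_def[symmetric]]
    and punf = ntheta_pair_unfold[OF w, unfolded qw W_def[symmetric]]
  have facts:
    "ntheta w 1 1 = (W (-23) * (theta48 q 1 * theta48 q 23))"
    "ntheta w 1 4 = (W (-80) * (theta48 q 4 * theta48 q 20))"
    "ntheta w 1 5 = (W (-95) * (theta48 q 5 * theta48 q 19))"
    "ntheta w 1 6 = (W (-108) * (theta48 q 6 * theta48 q 18))"
    "ntheta w 1 7 = (W (-119) * (theta48 q 7 * theta48 q 17))"
    "ntheta w 1 9 = (W (-135) * (theta48 q 9 * theta48 q 15))"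
    "ntheta w 1 11 = (W (-143) * (theta48 q 11 * theta48 q 13))"
    and pairs:
    "ntheta w 1 2 * ntheta w (- 1) 2 = (W (-88) * theta48 q 4)"
    "ntheta w 1 3 * ntheta w (- 1) 3 = (W (-126) * theta48 q 6)"
    "ntheta w 1 4 * ntheta w (- 1) 4 = (W (-160) * theta48 q 8)"
    "ntheta w 1 5 * ntheta w (- 1) 5 = (W (-190) * theta48 q 10)"
    "ntheta w 1 9 * ntheta w (- 1) 9 = (W (-270) * theta48 q 18)"
    using unf[of 1 0] unf[of 4 0] unf[of 5 0] unf[of 6 0] unf[of 7 0] unf[of 9 0] unf[of 11 0]
      punf[of 2 0] punf[of 3 0] punf[of 4 0] punf[of 5 0] punf[of 9 0]
    by simp_all
  have "ntheta w 1 (int 1 * 8) \<noteq> 0"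
    using ntheta_nonzero[OF w, of 8 0] by simp
  note id = ntheta_identity[OF w _ this, simplified, unfolded pairs, unfolded facts]
  \<comment> \<open>The first product has the exponent \<open>- 119 - 88 - 270 = - 477\<close>. The
    second exceeds it by 48, which is one power of \<open>q\<close>; the right-hand side, with the
    \<open>576\<close> from duplication, agrees with it.\<close>
  have "W (-477) \<noteq> 0" using w by (simp add: W_def)
  moreover have P:
    "W (-119) * W (-88) * W (-270) = W (-477) * q ^ 0"
    "W (-143) * W (-126) * W (-160) = W (-477) * q ^ 1"
    "w ^ 576 * (W (-23) * W (-143) * W (-119) * W (-95) * W (-135) * W (-80) * W (-108) *
        W (-190) * W (-160)) = W (-477) * q ^ 0"
    by (simp_all only: W) simp_all
  moreover have "(W (-119) * W (-88) * W (-270)) * (theta48 q 4 * theta48 q 7 * theta48 q 17 *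
      theta48 q 18)
      - (W (-143) * W (-126) * W (-160)) * (theta48 q 6 * theta48 q 8 * theta48 q 11 * theta48 q 13)
      = (w ^ 576 * (W (-23) * W (-143) * W (-119) * W (-95) * W (-135) * W (-80) * W (-108) *
          W (-190) * W (-160))) * (theta48 q 1 * theta48 q 4 * theta48 q 5 * theta48 q 6 *
          theta48 q 7 * theta48 q 8 * theta48 q 9 * theta48 q 10 * theta48 q 11 * theta48 q 13 *
          theta48 q 15 * theta48 q 17 * theta48 q 18 * theta48 q 19 * theta48 q 20 * theta48 q 23)"
    using id by (simp add: mult_ac)
  then have "W (-477) * ((theta48 q 4 * theta48 q 7 * theta48 q 17 * theta48 q 18) - q *
      (theta48 q 6 * theta48 q 8 * theta48 q 11 * theta48 q 13) - (theta48 q 1 * theta48 q 4 *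
      theta48 q 5 * theta48 q 6 * theta48 q 7 * theta48 q 8 * theta48 q 9 * theta48 q 10 *
      theta48 q 11 * theta48 q 13 * theta48 q 15 * theta48 q 17 * theta48 q 18 * theta48 q 19 *
      theta48 q 20 * theta48 q 23)) = 0"
    unfolding P by (simp add: right_diff_distrib mult_ac)
  ultimately show ?thesis by simp
qed

text \<open>The case \<open>a = 5\<close>. The two products on the left change places while the
  right-hand side collects an odd number of minus signs, so the difference has the stated order. On
  the right the exponent exceeds the common one by 288, that is \<open>6 * 48\<close>: this is the
  origin of the exception \<open>n = 6\<close>.\<close>

lemma theta48_identity_ii:
  assumes q: "0 < q" "q < 1"
  shows "(theta48 q 7 * theta48 q 8 * theta48 q 17 * theta48 q 18)
       - (theta48 q 6 * theta48 q 11 * theta48 q 13 * theta48 q 20)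
       = q ^ 6 * (theta48 q 1 * theta48 q 2 * theta48 q 3 * theta48 q 4 * theta48 q 5 *
           theta48 q 6 * theta48 q 7 * theta48 q 8 * theta48 q 11 * theta48 q 13 * theta48 q 17 *
           theta48 q 18 * theta48 q 19 * theta48 q 20 * theta48 q 21 * theta48 q 23)"
proof -
  define w where "w = root 48 q"
  have w: "0 < w" "w < 1" and qw: "w ^ 48 = q"
    using q by (auto simp: w_def real_root_pow_pos2)
  define W where "W e = w powi e" for e
  have W: "W e * W f = W (e + f)" "q ^ d = W (48 * int d)" "w ^ 576 = W 576" for e f d
    using w by (simp_all add: W_def power_int_add power_int_mult flip: qw)
  note unf = ntheta_unfold[OF w, unfolded qw W_def[symmetric]]
    and punf = ntheta_pair_unfold[OF w, unfolded qw W_def[symmetric]]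
  have facts:
    "ntheta w 1 5 = (W (-95) * (theta48 q 5 * theta48 q 19))"
    "ntheta w 1 20 = (W (-80) * (theta48 q 20 * theta48 q 4))"
    "ntheta w 1 25 = - (W (-23) * (theta48 q 1 * theta48 q 23))"
    "ntheta w 1 30 = - (W (-108) * (theta48 q 6 * theta48 q 18))"
    "ntheta w 1 35 = - (W (-143) * (theta48 q 11 * theta48 q 13))"
    "ntheta w 1 45 = - (W (-63) * (theta48 q 21 * theta48 q 3))"
    "ntheta w 1 55 = (W (-119) * (theta48 q 7 * theta48 q 17))"
    and pairs:
    "ntheta w 1 10 * ntheta w (- 1) 10 = (W (-280) * theta48 q 20)"
    "ntheta w 1 15 * ntheta w (- 1) 15 = (W (-270) * theta48 q 18)"
    "ntheta w 1 20 * ntheta w (- 1) 20 = (W (-160) * theta48 q 8)"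
    "ntheta w 1 25 * ntheta w (- 1) 25 = - (W (-46) * theta48 q 2)"
    "ntheta w 1 45 * ntheta w (- 1) 45 = - (W (-126) * theta48 q 6)"
    using unf[of 5 0] unf[of 20 0] unf[of 1 1] unf[of 6 1] unf[of 11 1] unf[of 21 1] unf[of 7 2]
      punf[of 10 0] punf[of 15 0] punf[of 20 0] punf[of 1 1] punf[of 21 1]
      theta48_reflect[OF q(1), of 18] theta48_reflect[OF q(1), of 8] theta48_reflect[OF q(1), of 6]
    by simp_all
  have "ntheta w 1 (int 5 * 8) \<noteq> 0"
    using ntheta_nonzero[OF w, of 16 1] by simp
  note id = ntheta_identity[OF w _ this, simplified, unfolded pairs, unfolded facts]
  have "W (-549) \<noteq> 0" using w by (simp add: W_def)
  moreover have P:
    "W (-143) * W (-280) * W (-126) = W (-549) * q ^ 0"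
    "W (-119) * W (-270) * W (-160) = W (-549) * q ^ 0"
    "w ^ 576 * (W (-95) * W (-119) * W (-143) * W (-23) * W (-63) * W (-80) * W (-108) *
        W (-46) * W (-160)) = W (-549) * q ^ 6"
    by (simp_all only: W) simp_all
  moreover have "(W (-119) * W (-270) * W (-160)) * (theta48 q 7 * theta48 q 8 * theta48 q 17 *
      theta48 q 18)
      - (W (-143) * W (-280) * W (-126)) * (theta48 q 6 * theta48 q 11 * theta48 q 13 *
          theta48 q 20)
      = (w ^ 576 * (W (-95) * W (-119) * W (-143) * W (-23) * W (-63) * W (-80) * W (-108) *
          W (-46) * W (-160))) * (theta48 q 1 * theta48 q 2 * theta48 q 3 * theta48 q 4 *
          theta48 q 5 * theta48 q 6 * theta48 q 7 * theta48 q 8 * theta48 q 11 * theta48 q 13 *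
          theta48 q 17 * theta48 q 18 * theta48 q 19 * theta48 q 20 * theta48 q 21 * theta48 q 23)"
    using id by (simp add: mult_ac)
  then have "W (-549) * ((theta48 q 7 * theta48 q 8 * theta48 q 17 * theta48 q 18)
      - (theta48 q 6 * theta48 q 11 * theta48 q 13 * theta48 q 20) - q ^ 6 * (theta48 q 1 *
      theta48 q 2 * theta48 q 3 * theta48 q 4 * theta48 q 5 * theta48 q 6 * theta48 q 7 *
      theta48 q 8 * theta48 q 11 * theta48 q 13 * theta48 q 17 * theta48 q 18 * theta48 q 19 *
      theta48 q 20 * theta48 q 21 * theta48 q 23)) = 0"
    unfolding P by (simp add: right_diff_distrib mult_ac)
  ultimately show ?thesis by simp
qed

text \<open>The case \<open>a = 7\<close>. The minus signs from the shifts cancel in pairs within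
  each of the three products.\<close>

lemma theta48_identity_iii:
  assumes q: "0 < q" "q < 1"
  shows "(theta48 q 1 * theta48 q 18 * theta48 q 20 * theta48 q 23)
       - q ^ 4 * (theta48 q 5 * theta48 q 6 * theta48 q 8 * theta48 q 19)
       = (theta48 q 1 * theta48 q 4 * theta48 q 5 * theta48 q 6 * theta48 q 7 * theta48 q 8 *
           theta48 q 9 * theta48 q 11 * theta48 q 13 * theta48 q 15 * theta48 q 17 *
           theta48 q 18 * theta48 q 19 * theta48 q 20 * theta48 q 22 * theta48 q 23)"
proof -
  define w where "w = root 48 q"
  have w: "0 < w" "w < 1" and qw: "w ^ 48 = q"
    using q by (auto simp: w_def real_root_pow_pos2)
  define W where "W e = w powi e" for e
  have W: "W e * W f = W (e + f)" "q ^ d = W (48 * int d)" "w ^ 576 = W 576" for e f d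
    using w by (simp_all add: W_def power_int_add power_int_mult flip: qw)
  note unf = ntheta_unfold[OF w, unfolded qw W_def[symmetric]]
    and punf = ntheta_pair_unfold[OF w, unfolded qw W_def[symmetric]]
  have facts:
    "ntheta w 1 7 = (W (-119) * (theta48 q 7 * theta48 q 17))"
    "ntheta w 1 28 = - (W (-80) * (theta48 q 4 * theta48 q 20))"
    "ntheta w 1 35 = - (W (-143) * (theta48 q 11 * theta48 q 13))"
    "ntheta w 1 42 = - (W (-108) * (theta48 q 18 * theta48 q 6))"
    "ntheta w 1 49 = (W (-23) * (theta48 q 1 * theta48 q 23))"
    "ntheta w 1 63 = (W (-135) * (theta48 q 15 * theta48 q 9))"
    "ntheta w 1 77 = - (W (-95) * (theta48 q 5 * theta48 q 19))"
    and pairs: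
    "ntheta w 1 14 * ntheta w (- 1) 14 = (W (-280) * theta48 q 20)"
    "ntheta w 1 21 * ntheta w (- 1) 21 = (W (-126) * theta48 q 6)"
    "ntheta w 1 28 * ntheta w (- 1) 28 = - (W (-160) * theta48 q 8)"
    "ntheta w 1 35 * ntheta w (- 1) 35 = - (W (-286) * theta48 q 22)"
    "ntheta w 1 63 * ntheta w (- 1) 63 = (W (-270) * theta48 q 18)"
    using unf[of 7 0] unf[of 4 1] unf[of 11 1] unf[of 18 1] unf[of 1 2] unf[of 15 2] unf[of 5 3]
      punf[of 14 0] punf[of 21 0] punf[of 4 1] punf[of 11 1] punf[of 15 2]
      theta48_reflect[OF q(1), of 20] theta48_reflect[OF q(1), of 6] theta48_reflect[OF q(1), of 18]
    by simp_all
  have "ntheta w 1 (int 7 * 8) \<noteq> 0"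
    using ntheta_nonzero[OF w, of 8 2] by simp
  note id = ntheta_identity[OF w _ this, simplified, unfolded pairs, unfolded facts]
  have "W (-573) \<noteq> 0" using w by (simp add: W_def)
  moreover have P:
    "W (-23) * W (-280) * W (-270) = W (-573) * q ^ 0"
    "W (-95) * W (-126) * W (-160) = W (-573) * q ^ 4"
    "w ^ 576 * (W (-119) * W (-95) * W (-23) * W (-143) * W (-135) * W (-80) * W (-108) *
        W (-286) * W (-160)) = W (-573) * q ^ 0"
    by (simp_all only: W) simp_all
  moreover have "(W (-23) * W (-280) * W (-270)) * (theta48 q 1 * theta48 q 18 * theta48 q 20 *
      theta48 q 23)
      - (W (-95) * W (-126) * W (-160)) * (theta48 q 5 * theta48 q 6 * theta48 q 8 * theta48 q 19)
      = (w ^ 576 * (W (-119) * W (-95) * W (-23) * W (-143) * W (-135) * W (-80) * W (-108) *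
          W (-286) * W (-160))) * (theta48 q 1 * theta48 q 4 * theta48 q 5 * theta48 q 6 *
          theta48 q 7 * theta48 q 8 * theta48 q 9 * theta48 q 11 * theta48 q 13 * theta48 q 15 *
          theta48 q 17 * theta48 q 18 * theta48 q 19 * theta48 q 20 * theta48 q 22 * theta48 q 23)"
    using id by (simp add: mult_ac)
  then have "W (-573) * ((theta48 q 1 * theta48 q 18 * theta48 q 20 * theta48 q 23) - q ^ 4 *
      (theta48 q 5 * theta48 q 6 * theta48 q 8 * theta48 q 19) - (theta48 q 1 * theta48 q 4 *
      theta48 q 5 * theta48 q 6 * theta48 q 7 * theta48 q 8 * theta48 q 9 * theta48 q 11 *
      theta48 q 13 * theta48 q 15 * theta48 q 17 * theta48 q 18 * theta48 q 19 * theta48 q 20 *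
      theta48 q 22 * theta48 q 23)) = 0"
    unfolding P by (simp add: right_diff_distrib mult_ac)
  ultimately show ?thesis by simp
qed

text \<open>The case \<open>a = 11\<close>. The products on the left change places and each acquires
  a minus sign, so the difference keeps its form; on the right the number of signs is even.\<close>

lemma theta48_identity_iv:
  assumes q: "0 < q" "q < 1"
  shows "(theta48 q 1 * theta48 q 8 * theta48 q 18 * theta48 q 23)
       - q ^ 3 * (theta48 q 4 * theta48 q 5 * theta48 q 6 * theta48 q 19)
       = (theta48 q 1 * theta48 q 3 * theta48 q 4 * theta48 q 5 * theta48 q 6 * theta48 q 7 *
           theta48 q 8 * theta48 q 11 * theta48 q 13 * theta48 q 14 * theta48 q 17 *
           theta48 q 18 * theta48 q 19 * theta48 q 20 * theta48 q 21 * theta48 q 23)"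
proof -
  define w where "w = root 48 q"
  have w: "0 < w" "w < 1" and qw: "w ^ 48 = q"
    using q by (auto simp: w_def real_root_pow_pos2)
  define W where "W e = w powi e" for e
  have W: "W e * W f = W (e + f)" "q ^ d = W (48 * int d)" "w ^ 576 = W 576" for e f d
    using w by (simp_all add: W_def power_int_add power_int_mult flip: qw)
  note unf = ntheta_unfold[OF w, unfolded qw W_def[symmetric]]
    and punf = ntheta_pair_unfold[OF w, unfolded qw W_def[symmetric]]
  have facts:
    "ntheta w 1 11 = (W (-143) * (theta48 q 11 * theta48 q 13))"
    "ntheta w 1 44 = - (W (-80) * (theta48 q 20 * theta48 q 4))"
    "ntheta w 1 55 = (W (-119) * (theta48 q 7 * theta48 q 17))"
    "ntheta w 1 66 = (W (-108) * (theta48 q 18 * theta48 q 6))"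
    "ntheta w 1 77 = - (W (-95) * (theta48 q 5 * theta48 q 19))"
    "ntheta w 1 99 = (W (-63) * (theta48 q 3 * theta48 q 21))"
    "ntheta w 1 121 = - (W (-23) * (theta48 q 1 * theta48 q 23))"
    and pairs:
    "ntheta w 1 22 * ntheta w (- 1) 22 = (W (-88) * theta48 q 4)"
    "ntheta w 1 33 * ntheta w (- 1) 33 = - (W (-270) * theta48 q 18)"
    "ntheta w 1 44 * ntheta w (- 1) 44 = - (W (-160) * theta48 q 8)"
    "ntheta w 1 55 * ntheta w (- 1) 55 = (W (-238) * theta48 q 14)"
    "ntheta w 1 99 * ntheta w (- 1) 99 = (W (-126) * theta48 q 6)"
    using unf[of 11 0] unf[of 20 1] unf[of 7 2] unf[of 18 2] unf[of 5 3] unf[of 3 4] unf[of 1 5]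
      punf[of 22 0] punf[of 9 1] punf[of 20 1] punf[of 7 2] punf[of 3 4]
      theta48_reflect[OF q(1), of 4] theta48_reflect[OF q(1), of 8]
    by simp_all
  have "ntheta w 1 (int 11 * 8) \<noteq> 0"
    using ntheta_nonzero[OF w, of 16 3] by simp
  note id = ntheta_identity[OF w _ this, simplified, unfolded pairs, unfolded facts]
  have "W (-453) \<noteq> 0" using w by (simp add: W_def)
  moreover have P:
    "W (-95) * W (-88) * W (-126) = W (-453) * q ^ 3"
    "W (-23) * W (-270) * W (-160) = W (-453) * q ^ 0"
    "w ^ 576 * (W (-143) * W (-23) * W (-95) * W (-119) * W (-63) * W (-80) * W (-108) *
        W (-238) * W (-160)) = W (-453) * q ^ 0"
    by (simp_all only: W) simp_all
  moreover have "(W (-23) * W (-270) * W (-160)) * (theta48 q 1 * theta48 q 8 * theta48 q 18 *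
      theta48 q 23)
      - (W (-95) * W (-88) * W (-126)) * (theta48 q 4 * theta48 q 5 * theta48 q 6 * theta48 q 19)
      = (w ^ 576 * (W (-143) * W (-23) * W (-95) * W (-119) * W (-63) * W (-80) * W (-108) *
          W (-238) * W (-160))) * (theta48 q 1 * theta48 q 3 * theta48 q 4 * theta48 q 5 *
          theta48 q 6 * theta48 q 7 * theta48 q 8 * theta48 q 11 * theta48 q 13 * theta48 q 14 *
          theta48 q 17 * theta48 q 18 * theta48 q 19 * theta48 q 20 * theta48 q 21 * theta48 q 23)"
    using id by (simp add: mult_ac)
  then have "W (-453) * ((theta48 q 1 * theta48 q 8 * theta48 q 18 * theta48 q 23) - q ^ 3 *
      (theta48 q 4 * theta48 q 5 * theta48 q 6 * theta48 q 19) - (theta48 q 1 * theta48 q 3 *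
      theta48 q 4 * theta48 q 5 * theta48 q 6 * theta48 q 7 * theta48 q 8 * theta48 q 11 *
      theta48 q 13 * theta48 q 14 * theta48 q 17 * theta48 q 18 * theta48 q 19 * theta48 q 20 *
      theta48 q 21 * theta48 q 23)) = 0"
    unfolding P by (simp add: right_diff_distrib mult_ac)
  ultimately show ?thesis by simp
qed

section \<open>Generating functions of partitions\<close>

lemma partitions_into_insert:
  assumes "s \<notin> A"
  shows "partitions_into (insert s A) n = partitions_into A n \<union>
     (if s \<le> n then add_mset s ` partitions_into (insert s A) (n - s) else {})"
    (is "?L = ?R")
proof
  show "?L \<subseteq> ?R"
  proof
    fix P assume P: "P \<in> ?L"
    show "P \<in> ?R"
    proof (cases "s \<in># P")
      case True
      then obtain Q where Q: "P = add_mset s Q" by (blast dest: multi_member_split)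
      then show ?thesis using P by (auto simp: partitions_into_def)
    next
      case False
      then show ?thesis using P by (auto simp: partitions_into_def)
    qed
  qed
  show "?R \<subseteq> ?L" by (auto simp: partitions_into_def split: if_splits)
qed

text \<open>A partition either avoids \<open>s\<close> or arises by adding one part \<open>s\<close>
  to a partition of \<open>n - s\<close>. For generating functions this is division by
  \<open>1 - q ^ s\<close>.\<close>

lemma num_partitions_insert:
  assumes "s \<notin> A" "0 < s" "0 \<notin> A"
  shows "num_partitions (insert s A) n = num_partitions A n +
     (if s \<le> n then num_partitions (insert s A) (n - s) else 0)"
proof -
  have "finite (partitions_into (insert s A) k)" "finite (partitions_into A k)" for k
    using assms by (auto intro!: finite_partitions_into)
  moreover have "partitions_into A n \<inter> add_mset s ` X = {}" for X
    using assms by (auto simp: partitions_into_def)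
  moreover have "card (add_mset s ` X) = card X" for X
    by (rule card_image) (simp add: inj_on_def)
  ultimately show ?thesis
    unfolding num_partitions_def by (subst partitions_into_insert[OF assms(1)]) (simp add:
        card_Un_disjoint)
qed

lemma num_partitions_empty: "num_partitions {} n = (if n = 0 then 1 else 0)"
proof -
  have "partitions_into {} n = (if n = 0 then {{#}} else {})"
    by (auto simp: partitions_into_def)
  then show ?thesis by (simp add: num_partitions_def)
qed

lemma partition_generating_function_finite:
  fixes q :: real
  assumes "finite A" "0 \<notin> A" and q: "0 < q" "q < 1"
  shows "(\<lambda>n. num_partitions A n * q ^ n) sums (1 / (\<Prod>s\<in>A. 1 - q ^ s))"
  using assms(1,2)
proof (induction A rule: finite_induct)
  case empty
  show ?case using sums_If_finite[of "\<lambda>n. n = 0" "\<lambda>n. q ^ n"]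
    by (simp add: num_partitions_empty if_distrib[of "\<lambda>x. real x * _"] cong: if_cong)
next
  case (insert s A)
  define a where "a n = num_partitions A n * q ^ n" for n
  define b where "b n = num_partitions (insert s A) n * q ^ n" for n
  define L where "L = 1 / (\<Prod>s\<in>A. 1 - q ^ s)"
  have s: "s > 0" using insert by (cases s) auto
  have qs: "0 < q ^ s" "q ^ s < 1" using q s by (auto simp: power_less_one_iff)
  have a: "a sums L" using insert unfolding a_def L_def by simp
  have nn: "a n \<ge> 0" "b n \<ge> 0" for n using q by (auto simp: a_def b_def)
  have rec: "b n = a n + (if s \<le> n then q ^ s * b (n - s) else 0)" for n
  proof -
    have "q ^ n = q ^ s * q ^ (n - s)" if "s \<le> n" using that by (simp flip: power_add)
    then show ?thesis
      using insert s unfolding a_def b_def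
      by (subst num_partitions_insert) (auto simp: algebra_simps)
  qed
  \<comment> \<open>Summability of \<open>b\<close> has to precede any manipulation of its sum. The
    recurrence bounds a partial sum by \<open>L\<close> plus \<open>q ^ s\<close> times itself,
    which can be solved since \<open>q ^ s < 1\<close>.\<close>
  have bound: "(\<Sum>n<N. b n) \<le> L / (1 - q ^ s)" for N
  proof -
    have "(\<Sum>n<N. if s \<le> n then b (n - s) else 0) = (\<Sum>n\<in>{n. n < N \<and> s \<le> n}. b (n - s))"
      by (subst sum.inter_filter[symmetric]) (auto intro: sum.cong)
    also have "\<dots> = (\<Sum>n<N - s. b n)"
      by (rule sum.reindex_bij_witness[of _ "\<lambda>n. n + s" "\<lambda>n. n - s"]) auto
    also have "\<dots> \<le> (\<Sum>n<N. b n)"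
      using nn by (intro sum_mono2) auto
    finally have "q ^ s * (\<Sum>n<N. if s \<le> n then b (n - s) else 0) \<le> q ^ s * (\<Sum>n<N. b n)"
      using qs by (intro mult_left_mono) auto
    moreover have "(\<Sum>n<N. b n) = (\<Sum>n<N. a n) + q ^ s * (\<Sum>n<N. if s \<le> n then b (n - s) else 0)"
      by (subst rec) (auto simp: sum.distrib sum_distrib_left intro: sum.cong)
    moreover have "(\<Sum>n<N. a n) \<le> L"
      using a nn by (metis sums_iff sum_le_suminf finite_lessThan)
    ultimately show ?thesis using qs by (simp add: field_simps)
  qed
  have sb: "summable b"
    using bound nn by (intro summableI_nonneg_bounded)
  have sa: "summable a" and La: "suminf a = L" using a by (auto simp: sums_iff)
  have "suminf b = (\<Sum>n. b (n + s)) + (\<Sum>n<s. b n)"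
    using suminf_split_initial_segment[OF sb] .
  also have "(\<Sum>n. b (n + s)) = (\<Sum>n. a (n + s)) + q ^ s * suminf b"
  proof -
    have "b (n + s) = a (n + s) + q ^ s * b n" for n using rec[of "n + s"] by simp
    then show ?thesis
      using suminf_add[OF summable_ignore_initial_segment[OF sa, of s] summable_mult[OF sb, of "q
          ^ s"]]
        suminf_mult[OF sb, of "q ^ s"] by simp
  qed
  also have "(\<Sum>n<s. b n) = (\<Sum>n<s. a n)"
    using rec by (intro sum.cong) auto
  also have "(\<Sum>n. a (n + s)) + q ^ s * suminf b + (\<Sum>n<s. a n) = L + q ^ s * suminf b"
    using suminf_split_initial_segment[OF sa, of s] La by simp
  finally have eq: "suminf b = L + q ^ s * suminf b" .
  have "(1 - q ^ s) * suminf b = L"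
    unfolding left_diff_distrib using eq by linarith
  then have "suminf b = L / (1 - q ^ s)"
    using qs by (simp add: eq_divide_eq mult.commute)
  moreover have "L / (1 - q ^ s) = 1 / (\<Prod>s\<in>insert s A. 1 - q ^ s)"
    using insert by (simp add: L_def mult.commute)
  ultimately show ?case using sb unfolding b_def sums_iff by simp
qed

section \<open>Infinite sets of parts by truncation\<close>

lemma num_partitions_mono:
  assumes "A \<subseteq> B" "0 \<notin> B"
  shows "num_partitions A n \<le> num_partitions B n"
  unfolding num_partitions_def using assms
  by (intro card_mono finite_partitions_into) (auto simp: partitions_into_def)

lemma num_partitions_truncate:
  assumes "n < N"
  shows "num_partitions (S \<inter> {..<N}) n = num_partitions S n"
proof -
  have "x \<le> sum_mset P" if "x \<in># P" for x and P :: "nat multiset"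
    using multi_member_split[OF that] by auto
  then have "partitions_into (S \<inter> {..<N}) n = partitions_into S n"
    using assms by (fastforce simp: partitions_into_def)
  then show ?thesis by (simp add: num_partitions_def)
qed

text \<open>A monotone squeeze. Finitely many coefficients agree with those of a truncated set, so
  partial sums are at most \<open>1 / P\<close>; conversely every truncated series
  \<open>1 / Q N\<close> is below the full one and tends to \<open>1 / P\<close>. Truncation at
  multiples of \<open>M\<close> keeps blocks of residues complete.\<close>

lemma partition_generating_function:
  fixes q :: real
  assumes "0 \<notin> S" and q: "0 < q" "q < 1" and M: "0 < M"
    and lim: "(\<lambda>N. \<Prod>s\<in>S \<inter> {..<M * N}. 1 - q ^ s) \<longlonglongrightarrow> P" and P: "P > 0"
  shows "(\<lambda>n. num_partitions S n * q ^ n) sums (1 / P)"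
proof -
  define Q where "Q N = (\<Prod>s\<in>S \<inter> {..<M * N}. 1 - q ^ s)" for N
  have f: "0 < 1 - q ^ s" "1 - q ^ s \<le> 1" if "s \<in> S" for s
    using that assms(1) q by (cases s; auto simp: power_less_one_iff simp del: power_Suc)+
  have "decseq Q"
  proof (rule decseq_SucI)
    fix N
    have "Q (Suc N) = Q N * (\<Prod>s\<in>S \<inter> {M * N..<M * Suc N}. 1 - q ^ s)"
      unfolding Q_def by (subst prod.union_disjoint[symmetric]) (auto intro!: prod.cong)
    also have "\<dots> \<le> Q N * 1"
      unfolding Q_def using f
      by (intro mult_left_mono prod_le_1 prod_nonneg) (auto intro: less_imp_le)
    finally show "Q (Suc N) \<le> Q N" by simp
  qed
  then have QP: "Q N \<ge> P" for N
    using decseq_ge lim unfolding Q_def by blast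
  have fin: "(\<lambda>n. num_partitions (S \<inter> {..<M * N}) n * q ^ n) sums (1 / Q N)" for N
    unfolding Q_def using assms by (intro partition_generating_function_finite) auto
  have bound: "(\<Sum>n<K. num_partitions S n * q ^ n) \<le> 1 / P" for K
  proof -
    have "K \<le> M * K" using M by simp
    then have "(\<Sum>n<K. num_partitions S n * q ^ n)
        = (\<Sum>n<K. num_partitions (S \<inter> {..<M * K}) n * q ^ n)"
      by (intro sum.cong refl) (metis lessThan_iff num_partitions_truncate order.strict_trans2)
    also have "\<dots> \<le> 1 / Q K"
      using fin[of K] q by (metis (no_types, lifting) sums_iff sum_le_suminf finite_lessThan
          mult_nonneg_nonneg of_nat_0_le_iff zero_le_power less_imp_le)
    also have "\<dots> \<le> 1 / P" using QP P by (simp add: frac_le)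
    finally show ?thesis .
  qed
  have sm: "summable (\<lambda>n. num_partitions S n * q ^ n)"
    using bound q by (intro summableI_nonneg_bounded) auto
  have "(\<Sum>n. num_partitions S n * q ^ n) \<le> 1 / P"
    by (rule suminf_le_const[OF sm bound])
  moreover have "(\<Sum>n. num_partitions S n * q ^ n) \<ge> 1 / P"
  proof (rule tendsto_upperbound)
    show "(\<lambda>N. 1 / Q N) \<longlonglongrightarrow> 1 / P"
      using lim P unfolding Q_def by (intro tendsto_intros) auto
    have "1 / Q N \<le> (\<Sum>n. num_partitions S n * q ^ n)" for N
    proof -
      have "1 / Q N = (\<Sum>n. num_partitions (S \<inter> {..<M * N}) n * q ^ n)"
        using fin[of N] by (rule sums_unique)
      also have "\<dots> \<le> (\<Sum>n. num_partitions S n * q ^ n)"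
      proof (rule suminf_le)
        fix n
        show "num_partitions (S \<inter> {..<M * N}) n * q ^ n \<le> num_partitions S n * q ^ n"
          using q assms(1) by (intro mult_right_mono) (auto intro: num_partitions_mono)
      qed (use fin[of N] sm in \<open>auto simp: sums_iff\<close>)
      finally show ?thesis .
    qed
    then show "eventually (\<lambda>N. 1 / Q N \<le> (\<Sum>n. num_partitions S n * q ^ n)) sequentially"
      by simp
  qed simp
  ultimately show ?thesis using sm by (simp add: sums_iff)
qed

section \<open>Residue classes and products of thetas\<close>

lemma pm_residues_iff:
  assumes R: "\<And>r. r \<in> R \<Longrightarrow> 0 < r \<and> 2 * r < M"
  shows "n \<in> pm_residues R M \<longleftrightarrow> n mod M \<in> R \<union> (\<lambda>r. M - r) ` R"
proof -
  have 1: "[int n = int r] (mod int M) \<longleftrightarrow> n mod M = r" if "r \<in> R" for r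
    unfolding cong_int_iff using R[OF that] by (auto simp: Cong.cong_def)
  have 2: "[int n = - int r] (mod int M) \<longleftrightarrow> n mod M = M - r" if "r \<in> R" for r
  proof -
    have "[- int r = int (M - r)] (mod int M)"
      using R[OF that] by (simp add: Cong.cong_def of_nat_diff)
    then have "[int n = - int r] (mod int M) \<longleftrightarrow> [int n = int (M - r)] (mod int M)"
      using cong_trans cong_sym by blast
    then show ?thesis unfolding cong_int_iff using R[OF that] by (auto simp: Cong.cong_def)
  qed
  have "n > 0" if "n mod M \<in> R \<union> (\<lambda>r. M - r) ` R"
    using that by (cases "n = 0") (auto dest!: R)
  then show ?thesis unfolding pm_residues_def using 1 2 by auto
qed

text \<open>Each block of \<open>M\<close> consecutive integers meets every class \<open>r\<close>
  and \<open>M - r\<close> exactly once; \<open>0 < r\<close> and \<open>2 * r < M\<close> keep all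
  these classes distinct.\<close>

lemma prod_pm_residues:
  fixes f :: "nat \<Rightarrow> real"
  assumes "finite R" and R: "\<And>r. r \<in> R \<Longrightarrow> 0 < r \<and> 2 * r < M" and M: "0 < M"
  shows "(\<Prod>s\<in>pm_residues R M \<inter> {..<M * N}. f s)
       = (\<Prod>r\<in>R. (\<Prod>i<N. f (r + M * i)) * (\<Prod>i<N. f (M - r + M * i)))"
proof (induction N)
  case (Suc N)
  let ?R' = "(\<lambda>r. M - r) ` R"
  have block: "pm_residues R M \<inter> {M * N..<M * Suc N} = (\<lambda>j. j + M * N) ` (R \<union> ?R')"
  proof (intro equalityI subsetI)
    fix n assume n: "n \<in> pm_residues R M \<inter> {M * N..<M * Suc N}"
    then have "n div M = N" using M by (auto intro!: div_nat_eqI simp: mult.commute)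
    then have "n = n mod M + M * N" by (metis mod_mult_div_eq)
    then show "n \<in> (\<lambda>j. j + M * N) ` (R \<union> ?R')"
      using n pm_residues_iff[OF R] by blast
  next
    fix n assume "n \<in> (\<lambda>j. j + M * N) ` (R \<union> ?R')"
    then obtain j where j: "n = j + M * N" "j \<in> R \<union> ?R'" by auto
    then have "j < M" using R by force
    then show "n \<in> pm_residues R M \<inter> {M * N..<M * Suc N}"
      using j by (simp add: pm_residues_iff[OF R])
  qed
  have "M - r \<notin> R" if "r \<in> R" for r
    using R[OF that] R[of "M - r"] by auto
  then have "R \<inter> ?R' = {}" by auto
  moreover have "inj_on (\<lambda>r. M - r) R"
  proof (rule inj_onI)
    fix x y assume "x \<in> R" "y \<in> R" "M - x = M - y"
    then show "x = y" using R[of x] R[of y] by linarith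
  qed
  moreover have "inj_on (\<lambda>j. j + M * N) X" for X by (simp add: inj_on_def)
  ultimately have new: "(\<Prod>s\<in>pm_residues R M \<inter> {M * N..<M * Suc N}. f s)
      = (\<Prod>r\<in>R. f (r + M * N) * f (M - r + M * N))"
    unfolding block using assms(1)
    by (simp add: prod.reindex prod.union_disjoint prod.distrib)
  have split: "pm_residues R M \<inter> {..<M * Suc N}
     = (pm_residues R M \<inter> {..<M * N}) \<union> (pm_residues R M \<inter> {M * N..<M * Suc N})"
    by auto
  have "(\<Prod>s\<in>pm_residues R M \<inter> {..<M * Suc N}. f s)
     = (\<Prod>s\<in>pm_residues R M \<inter> {..<M * N}. f s) * (\<Prod>s\<in>pm_residues R M \<inter> {M * N..<M * Suc N}. f s)"
    unfolding split by (subst prod.union_disjoint) auto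
  then show ?case
    unfolding Suc.IH new by (simp add: prod.distrib mult_ac)
qed simp

lemma pm_residues_generating_function:
  fixes q :: real
  assumes "finite R" and R: "\<And>r. r \<in> R \<Longrightarrow> 0 < r \<and> 2 * r < M" and M: "0 < M"
    and q: "0 < q" "q < 1"
  shows "(\<lambda>n. num_partitions (pm_residues R M) n * q ^ n) sums (1 / (\<Prod>r\<in>R. theta (q ^ r) (q ^ M)))"
proof (rule partition_generating_function[OF zero_notin_pm_residues q M])
  have qM: "0 < q ^ M" "q ^ M < 1" using q M by (auto simp: power_less_one_iff)
  have e: "q ^ (r + M * i) = q ^ r * (q ^ M) ^ i" for r i
    by (simp add: power_add power_mult)
  have prods: "(\<Prod>s\<in>pm_residues R M \<inter> {..<M * N}. 1 - q ^ s)
      = (\<Prod>r\<in>R. (\<Prod>i<N. 1 - q ^ r * (q ^ M) ^ i) * (\<Prod>i<N. 1 - q ^ (M - r) * (q ^ M) ^ i))" for N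
    using prod_pm_residues[OF assms(1-3), where f = "\<lambda>s. 1 - q ^ s" and N = N] by (simp only: e)
  show "(\<lambda>N. \<Prod>s\<in>pm_residues R M \<inter> {..<M * N}. 1 - q ^ s) \<longlonglongrightarrow> (\<Prod>r\<in>R. theta (q ^ r) (q ^ M))"
    unfolding prods theta_def
  proof (intro tendsto_prod tendsto_mult qpoch_LIMSEQ qM)
    fix r assume "r \<in> R"
    then have "q ^ (M - r) = q ^ M / q ^ r" using R q by (intro power_diff) force+
    then show "(\<lambda>N. \<Prod>i<N. 1 - q ^ (M - r) * (q ^ M) ^ i) \<longlonglongrightarrow> qpoch (q ^ M / q ^ r) (q ^ M)"
      by (simp only:) (intro qpoch_LIMSEQ qM)
  qed
  show "(\<Prod>r\<in>R. theta (q ^ r) (q ^ M)) > 0"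
  proof (intro prod_pos ballI theta_pos qM)
    fix r assume "r \<in> R"
    then have "0 < r" "r < M" using R by force+
    then show "q ^ M < q ^ r" "q ^ r < 1"
      using q by (auto simp: power_strict_decreasing power_less_one_iff)
  qed
qed

section \<open>Comparison of coefficients\<close>

lemma power_series_coeffs_eq:
  fixes a b :: "nat \<Rightarrow> real"
  assumes a: "\<And>q. 0 < q \<Longrightarrow> q < 1 \<Longrightarrow> (\<lambda>n. a n * q ^ n) sums f q"
    and b: "\<And>q. 0 < q \<Longrightarrow> q < 1 \<Longrightarrow> (\<lambda>n. b n * q ^ n) sums f q"
  shows "a = b"
proof (rule ccontr)
  assume "a \<noteq> b"
  then obtain m where m: "a m - b m \<noteq> 0" by (auto simp: fun_eq_iff)
  \<comment> \<open>The difference series is multiplied by \<open>q\<close>. It then vanishes at 0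
    in any case, and its nonzero coefficient sits at the positive index \<open>Suc m\<close>, as
    \<open>powser_0_nonzero\<close> requires to isolate the zero.\<close>
  define d where "d n = (if n = 0 then 0 else a (n - 1) - b (n - 1))" for n
  have d: "(\<lambda>n. d n * q ^ n) sums 0" if "0 < q" "q < 1" for q
  proof -
    have "(\<lambda>n. d (Suc n) * q ^ Suc n) sums (q * 0)"
      using sums_mult[OF sums_diff[OF a[OF that] b[OF that]], of q]
      by (simp add: d_def algebra_simps)
    then show ?thesis using sums_Suc_iff[of "\<lambda>n. d n * q ^ n"] by (simp add: d_def)
  qed
  define h where "h x = (\<Sum>n. d n * x ^ n)" for x :: real
  have h: "(\<lambda>n. d n * x ^ n) sums h x" if "\<bar>x\<bar> < 1 / 2" for x
    unfolding h_def
    by (rule summable_sums, rule powser_inside[of _ "1 / 2"]) (use d[of "1 / 2"] that in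
        \<open>auto simp: sums_iff\<close>)
  have "h 0 = 0" using h[of 0] by (simp add: h_def d_def)
  then obtain s where s: "0 < s" "\<And>z. z \<in> cball 0 s - {0} \<Longrightarrow> h z \<noteq> 0"
    using powser_0_nonzero[of "1 / 2" 0 d h "Suc m"] h m by (auto simp: d_def)
  have "0 < min s (1 / 4)" "min s (1 / 4) < 1" using s(1) by auto
  from d[OF this] have "h (min s (1 / 4)) = 0" by (simp add: h_def sums_iff)
  moreover have "min s (1 / 4) \<in> cball 0 s - {0}" using s by auto
  ultimately show False using s(2) by blast
qed

text \<open>The summand \<open>q ^ i\<close> contributes 1 to the coefficient at \<open>i\<close>
  and nothing elsewhere, so all coefficients with \<open>n \<noteq> i\<close> are shifted by
  \<open>k\<close>; \<open>k \<le> n\<close> keeps \<open>n - k\<close> a genuine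
  difference.\<close>

lemma num_partitions_shift:
  fixes i k n :: nat
  assumes "finite R" and R: "\<And>r. r \<in> R \<Longrightarrow> 0 < r \<and> 2 * r < M"
    and "finite R'" and R': "\<And>r. r \<in> R' \<Longrightarrow> 0 < r \<and> 2 * r < M"
    and M: "0 < M"
    and id: "\<And>q :: real. 0 < q \<Longrightarrow> q < 1 \<Longrightarrow>
      1 / (\<Prod>r\<in>R. theta (q ^ r) (q ^ M)) = q ^ i + q ^ k / (\<Prod>r\<in>R'. theta (q ^ r) (q ^ M))"
    and n: "n \<ge> k" "n \<noteq> i"
  shows "num_partitions (pm_residues R M) n = num_partitions (pm_residues R' M) (n - k)"
proof -
  define a where "a n = real (num_partitions (pm_residues R M) n)" for n
  define b where "b n = real (num_partitions (pm_residues R' M) n)" for n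
  define d where "d n = (if n = i then 1 else 0) + (if k \<le> n then b (n - k) else 0)" for n
  have "a = d"
  proof (rule power_series_coeffs_eq)
    fix q :: real assume q: "0 < q" "q < 1"
    show "(\<lambda>n. a n * q ^ n) sums (1 / (\<Prod>r\<in>R. theta (q ^ r) (q ^ M)))"
      unfolding a_def using assms q by (intro pm_residues_generating_function) auto
    have "(\<lambda>n. b n * q ^ n) sums (1 / (\<Prod>r\<in>R'. theta (q ^ r) (q ^ M)))"
      unfolding b_def using assms q by (intro pm_residues_generating_function) auto
    from sums_mult[OF this, of "q ^ k"]
    have "(\<lambda>n. (if k \<le> n + k then b (n + k - k) else 0) * q ^ (n + k))
        sums (q ^ k / (\<Prod>r\<in>R'. theta (q ^ r) (q ^ M)))"
      by (simp add: power_add mult_ac)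
    then have "(\<lambda>n. (if k \<le> n then b (n - k) else 0) * q ^ n)
        sums (q ^ k / (\<Prod>r\<in>R'. theta (q ^ r) (q ^ M)))"
      by (subst (asm) sums_zero_iff_shift) auto
    from sums_add[OF sums_single[of i "\<lambda>n. q ^ n"] this]
    show "(\<lambda>n. d n * q ^ n) sums (1 / (\<Prod>r\<in>R. theta (q ^ r) (q ^ M)))"
      unfolding id[OF q] d_def by (simp add: distrib_right if_distrib[of "\<lambda>x. x * _"] cong: if_cong)
  qed
  then have "a n = d n" by simp
  then show ?thesis using n by (simp add: a_def b_def d_def)
qed

section \<open>The partition identities\<close>

lemma reciprocal_identity:
  fixes c s t x y :: real
  assumes "c > 0" "s > 0" "t > 0" "t - x * s = y * (c * s * t)"
  shows "1 / (c * s) = y + x / (c * t)"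
proof -
  have "1 / (c * s) - x / (c * t) = (t - x * s) / (c * s * t)"
    using assms(1-3) by (simp add: field_simps)
  then show ?thesis using assms by simp
qed

lemma num_partitions_identity_i:
  assumes "n \<ge> 1" "n \<noteq> 0"
  shows "num_partitions (pm_residues {1, 5, 6, 8, 9, 10, 11, 13, 15, 19, 20, 23} 48) n
       = num_partitions (pm_residues {1, 4, 5, 7, 9, 10, 15, 17, 18, 19, 20, 23} 48) (n - 1)"
proof (rule num_partitions_shift[OF _ _ _ _ _ _ assms])
  fix q :: real assume q: "0 < q" "q < 1"
  define c where "c = theta48 q 1 * theta48 q 5 * theta48 q 9 * theta48 q 10 * theta48 q 15 *
      theta48 q 19 * theta48 q 20 * theta48 q 23"
  define s where "s = theta48 q 6 * theta48 q 8 * theta48 q 11 * theta48 q 13"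
  define t where "t = theta48 q 4 * theta48 q 7 * theta48 q 17 * theta48 q 18"
  have "c > 0" "s > 0" "t > 0"
    unfolding c_def s_def t_def using q by (intro mult_pos_pos theta48_pos; simp)+
  moreover have "t - q ^ 1 * s = q ^ 0 * (c * s * t)"
    using theta48_identity_i[OF q] by (simp add: c_def s_def t_def mult_ac)
  ultimately have "1 / (c * s) = q ^ 0 + q ^ 1 / (c * t)"
    by (rule reciprocal_identity)
  moreover have "(\<Prod>r\<in>{1, 5, 6, 8, 9, 10, 11, 13, 15, 19, 20, 23}. theta (q ^ r) (q ^ 48)) = c * s"
    "(\<Prod>r\<in>{1, 4, 5, 7, 9, 10, 15, 17, 18, 19, 20, 23}. theta (q ^ r) (q ^ 48)) = c * t"
    unfolding theta48_def[symmetric] by (simp_all add: c_def s_def t_def mult_ac)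
  ultimately show "1 / (\<Prod>r\<in>{1, 5, 6, 8, 9, 10, 11, 13, 15, 19, 20, 23}. theta (q ^ r) (q ^ 48))
      = q ^ 0 + q ^ 1 / (\<Prod>r\<in>{1, 4, 5, 7, 9, 10, 15, 17, 18, 19, 20, 23}. theta (q ^ r) (q ^ 48))"
    by simp
qed auto

lemma num_partitions_identity_ii:
  assumes "n \<ge> 0" "n \<noteq> 6"
  shows "num_partitions (pm_residues {1, 2, 3, 4, 5, 6, 11, 13, 19, 20, 21, 23} 48) n
       = num_partitions (pm_residues {1, 2, 3, 4, 5, 7, 8, 17, 18, 19, 21, 23} 48) (n - 0)"
proof (rule num_partitions_shift[OF _ _ _ _ _ _ assms])
  fix q :: real assume q: "0 < q" "q < 1"
  define c where "c = theta48 q 1 * theta48 q 2 * theta48 q 3 * theta48 q 4 * theta48 q 5 *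
      theta48 q 19 * theta48 q 21 * theta48 q 23"
  define s where "s = theta48 q 6 * theta48 q 11 * theta48 q 13 * theta48 q 20"
  define t where "t = theta48 q 7 * theta48 q 8 * theta48 q 17 * theta48 q 18"
  have "c > 0" "s > 0" "t > 0"
    unfolding c_def s_def t_def using q by (intro mult_pos_pos theta48_pos; simp)+
  moreover have "t - q ^ 0 * s = q ^ 6 * (c * s * t)"
    using theta48_identity_ii[OF q] by (simp add: c_def s_def t_def mult_ac)
  ultimately have "1 / (c * s) = q ^ 6 + q ^ 0 / (c * t)"
    by (rule reciprocal_identity)
  moreover have "(\<Prod>r\<in>{1, 2, 3, 4, 5, 6, 11, 13, 19, 20, 21, 23}. theta (q ^ r) (q ^ 48)) = c * s"
    "(\<Prod>r\<in>{1, 2, 3, 4, 5, 7, 8, 17, 18, 19, 21, 23}. theta (q ^ r) (q ^ 48)) = c * t"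
    unfolding theta48_def[symmetric] by (simp_all add: c_def s_def t_def mult_ac)
  ultimately show "1 / (\<Prod>r\<in>{1, 2, 3, 4, 5, 6, 11, 13, 19, 20, 21, 23}. theta (q ^ r) (q ^ 48))
      = q ^ 6 + q ^ 0 / (\<Prod>r\<in>{1, 2, 3, 4, 5, 7, 8, 17, 18, 19, 21, 23}. theta (q ^ r) (q ^ 48))"
    by simp
qed auto

lemma num_partitions_identity_iii:
  assumes "n \<ge> 4" "n \<noteq> 0"
  shows "num_partitions (pm_residues {4, 5, 6, 7, 8, 9, 11, 13, 15, 17, 19, 22} 48) n
       = num_partitions (pm_residues {1, 4, 7, 9, 11, 13, 15, 17, 18, 20, 22, 23} 48) (n - 4)"
proof (rule num_partitions_shift[OF _ _ _ _ _ _ assms])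
  fix q :: real assume q: "0 < q" "q < 1"
  define c where "c = theta48 q 4 * theta48 q 7 * theta48 q 9 * theta48 q 11 * theta48 q 13 *
      theta48 q 15 * theta48 q 17 * theta48 q 22"
  define s where "s = theta48 q 5 * theta48 q 6 * theta48 q 8 * theta48 q 19"
  define t where "t = theta48 q 1 * theta48 q 18 * theta48 q 20 * theta48 q 23"
  have "c > 0" "s > 0" "t > 0"
    unfolding c_def s_def t_def using q by (intro mult_pos_pos theta48_pos; simp)+
  moreover have "t - q ^ 4 * s = q ^ 0 * (c * s * t)"
    using theta48_identity_iii[OF q] by (simp add: c_def s_def t_def mult_ac)
  ultimately have "1 / (c * s) = q ^ 0 + q ^ 4 / (c * t)"
    by (rule reciprocal_identity)
  moreover have "(\<Prod>r\<in>{4, 5, 6, 7, 8, 9, 11, 13, 15, 17, 19, 22}. theta (q ^ r) (q ^ 48)) = c * s"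
    "(\<Prod>r\<in>{1, 4, 7, 9, 11, 13, 15, 17, 18, 20, 22, 23}. theta (q ^ r) (q ^ 48)) = c * t"
    unfolding theta48_def[symmetric] by (simp_all add: c_def s_def t_def mult_ac)
  ultimately show "1 / (\<Prod>r\<in>{4, 5, 6, 7, 8, 9, 11, 13, 15, 17, 19, 22}. theta (q ^ r) (q ^ 48))
      = q ^ 0 + q ^ 4 / (\<Prod>r\<in>{1, 4, 7, 9, 11, 13, 15, 17, 18, 20, 22, 23}. theta (q ^ r) (q ^ 48))"
    by simp
qed auto

lemma num_partitions_identity_iv:
  assumes "n \<ge> 3" "n \<noteq> 0"
  shows "num_partitions (pm_residues {3, 4, 5, 6, 7, 11, 13, 14, 17, 19, 20, 21} 48) n
       = num_partitions (pm_residues {1, 3, 7, 8, 11, 13, 14, 17, 18, 20, 21, 23} 48) (n - 3)"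
proof (rule num_partitions_shift[OF _ _ _ _ _ _ assms])
  fix q :: real assume q: "0 < q" "q < 1"
  define c where "c = theta48 q 3 * theta48 q 7 * theta48 q 11 * theta48 q 13 * theta48 q 14 *
      theta48 q 17 * theta48 q 20 * theta48 q 21"
  define s where "s = theta48 q 4 * theta48 q 5 * theta48 q 6 * theta48 q 19"
  define t where "t = theta48 q 1 * theta48 q 8 * theta48 q 18 * theta48 q 23"
  have "c > 0" "s > 0" "t > 0"
    unfolding c_def s_def t_def using q by (intro mult_pos_pos theta48_pos; simp)+
  moreover have "t - q ^ 3 * s = q ^ 0 * (c * s * t)"
    using theta48_identity_iv[OF q] by (simp add: c_def s_def t_def mult_ac)
  ultimately have "1 / (c * s) = q ^ 0 + q ^ 3 / (c * t)"
    by (rule reciprocal_identity)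
  moreover have "(\<Prod>r\<in>{3, 4, 5, 6, 7, 11, 13, 14, 17, 19, 20, 21}. theta (q ^ r) (q ^ 48)) = c * s"
    "(\<Prod>r\<in>{1, 3, 7, 8, 11, 13, 14, 17, 18, 20, 21, 23}. theta (q ^ r) (q ^ 48)) = c * t"
    unfolding theta48_def[symmetric] by (simp_all add: c_def s_def t_def mult_ac)
  ultimately show "1 / (\<Prod>r\<in>{3, 4, 5, 6, 7, 11, 13, 14, 17, 19, 20, 21}. theta (q ^ r) (q ^ 48))
      = q ^ 0 + q ^ 3 / (\<Prod>r\<in>{1, 3, 7, 8, 11, 13, 14, 17, 18, 20, 21, 23}. theta (q ^ r) (q ^ 48))"
    by simp
qed auto

theorem theorem7p5:
  shows "(\<forall>n::nat. n \<ge> 1 \<longrightarrow>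
     num_partitions (pm_residues {1, 5, 6, 8, 9, 10, 11, 13, 15, 19, 20, 23} 48) n =
     num_partitions (pm_residues {1, 4, 5, 7, 9, 10, 15, 17, 18, 19, 20, 23} 48) (n - 1)) \<and>
    (\<forall>n::nat. n \<noteq> 6 \<longrightarrow>
     num_partitions (pm_residues {1, 2, 3, 4, 5, 6, 11, 13, 19, 20, 21, 23} 48) n =
     num_partitions (pm_residues {1, 2, 3, 4, 5, 7, 8, 17, 18, 19, 21, 23} 48) n) \<and>
    (\<forall>n::nat. n \<ge> 4 \<longrightarrow>
     num_partitions (pm_residues {4, 5, 6, 7, 8, 9, 11, 13, 15, 17, 19, 22} 48) n =
     num_partitions (pm_residues {1, 4, 7, 9, 11, 13, 15, 17, 18, 20, 22, 23} 48) (n - 4)) \<and>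
    (\<forall>n::nat. n \<ge> 3 \<longrightarrow>
     num_partitions (pm_residues {3, 4, 5, 6, 7, 11, 13, 14, 17, 19, 20, 21} 48) n =
     num_partitions (pm_residues {1, 3, 7, 8, 11, 13, 14, 17, 18, 20, 21, 23} 48) (n - 3))"
  using num_partitions_identity_i num_partitions_identity_ii
    num_partitions_identity_iii num_partitions_identity_iv
  by auto

end
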